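(* There exist two complex analytic hypersurface germs $(X_1,0)$ and $(X_2,0)$ in $(\mathbb{C}^3,0)$ which have the same Lipschitz outer geometry but have distinct embedded topological types.
   Context: For a complex analytic germ $(X,0)\subset(\mathbb{C}^n,0)$, the outer metric on $X$ is the restriction to $X$ of the Euclidean distance of $\mathbb{C}^n$. Two germs $(X_1,0)$ and $(X_2,0)$ have the same Lipschitz outer geometry if there is a homeomorphism of germs $(X_1,0)\to(X_2,0)$ which, on small enough representatives, is bilipschitz with respect to the outer metrics. Two hypersurface germs $(X_1,0),(X_2,0)\subset(\mathbb{C}^n,0)$ have the same embedded topological type if there is a homeomorphism of germs $(\mathbb{C}^n,0)\to(\mathbb{C}^n,0)$ mapping $(X_1,0)$ onto $(X_2,0)$; otherwise their embedded topological types are distinct. *)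

theory Defs
  imports "HOL-Analysis.Analysis"
begin

text \<open>
  The space \<open>\<complex>\<^sup>n\<close> is \<^typ>\<open>complex ^ 'n\<close>, whose \<^const>\<open>dist\<close> is the Euclidean distance.
  A germ at the origin is given by a representing set (or function); every notion below depends
  only on the germ of its arguments, i.e. is unchanged when a representing set is replaced by
  one that coincides with it on a neighbourhood of the origin.
\<close>

text \<open>
  Holomorphy in several variables: complex differentiability, i.e. the (real) Frechet
  derivative exists and is complex linear. The intended \<open>U\<close> are open sets.
\<close>

definition holomorphic_several_on :: "(complex ^ 'n \<Rightarrow> complex) \<Rightarrow> (complex ^ 'n) set \<Rightarrow> bool"
  where "holomorphic_several_on f U \<longleftrightarrow>
    (\<forall>z\<in>U. \<exists>D. (f has_derivative D) (at z) \<and> (\<forall>c v. D (c *s v) = c * D v))"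

text \<open>
  The condition \<open>\<not> (\<forall>\<^sub>F z in nhds 0. f z = 0)\<close> says that the germ of \<open>f\<close> at the origin is nonzero; since \<open>U\<close> need not be
  connected, it is not enough that \<open>f\<close> is nonzero somewhere on \<open>U\<close>. The function \<open>f\<close> is not
  assumed to be reduced, since germs are considered as germs of sets.
\<close>

definition hypersurface_germ :: "(complex ^ 'n) set \<Rightarrow> bool"
  where "hypersurface_germ X \<longleftrightarrow>
    (\<exists>U f. open U \<and> 0 \<in> U \<and> holomorphic_several_on f U \<and>
      \<not> (\<forall>\<^sub>F z in nhds 0. f z = 0) \<and>
      f 0 = 0 \<and> X \<inter> U = {z \<in> U. f z = 0})"

text \<open>
  The restriction of the Euclidean distance of the ambient space to \<open>X \<inter> U\<close> is the outer metric.
\<close>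

definition same_Lipschitz_outer_geometry ::
    "(complex ^ 'n) set \<Rightarrow> (complex ^ 'm) set \<Rightarrow> bool"
  where "same_Lipschitz_outer_geometry X Y \<longleftrightarrow>
    (\<exists>U V h g K. open U \<and> 0 \<in> U \<and> open V \<and> 0 \<in> V \<and>
      homeomorphism (X \<inter> U) (Y \<inter> V) h g \<and> h 0 = 0 \<and>
      K-lipschitz_on (X \<inter> U) h \<and> K-lipschitz_on (Y \<inter> V) g)"

definition same_embedded_topological_type ::
    "(complex ^ 'n) set \<Rightarrow> (complex ^ 'n) set \<Rightarrow> bool"
  where "same_embedded_topological_type X Y \<longleftrightarrow>
    (\<exists>U V h g. open U \<and> 0 \<in> U \<and> open V \<and> 0 \<in> V \<and>
      homeomorphism U V h g \<and> h 0 = 0 \<and> h ` (X \<inter> U) = Y \<inter> V)"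

end

theory Submission imports Defs "HOL-Computational_Algebra.Polynomial"
begin

text \<open>
  The pair consists of non-isolated surfaces. Let \<open>p = y\<^sup>2 + 16 x\<^sup>2\<close>, \<open>q = 17 x y\<close> and let \<open>X\<^sub>s\<close> be the
  union of the three graphs \<open>z = 0\<close>, \<open>z = p\<^sup>2 - q\<^sup>2\<close>, \<open>z = p\<^sup>2\<close> and the two planes \<open>y = 16 x\<close>, \<open>y = s x\<close>,
  for \<open>s = 1\<close> and \<open>s = - 1\<close>. The outer metric only sees the gaps \<open>\<bar>p\<^sup>2\<bar>\<close>, \<open>\<bar>q\<^sup>2\<bar>\<close>, \<open>\<bar>p\<^sup>2 - q\<^sup>2\<bar>\<close> between
  the graphs up to bounded factors, and these are respected by a half twist in the slope \<open>y / x\<close> which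
  exchanges the slopes \<open>1\<close> and \<open>- 1\<close> and fixes all slopes of modulus at least \<open>3\<close>. The embedding also
  sees whether \<open>p = q\<close> or \<open>p = - q\<close> on a component of \<open>p\<^sup>2 = q\<^sup>2\<close>: consider a loop that goes from the
  first graph to the second along one of the two vertical planes and back along the other one. Its
  linking number with the third graph is always even if \<open>p = q\<close> over both planes, and can be odd if
  \<open>p = q\<close> over one and \<open>p = - q\<close> over the other.
\<close>

section \<open>The surfaces and their outer geometry\<close>

text \<open>The constants come from \<open>p - q = (y - x) (y - 16 x)\<close> and
  \<open>p + q = (y + x) (y + 16 x)\<close>. The gaps between the graphs vanish at the slopes
  \<open>4 i\<close>, \<open>- 4 i\<close> (from \<open>p\<close>), 0 and infinity (from
  \<open>q\<close>) and 1, -1, 16, -16 (from \<open>p^2 - q^2\<close>). Slopes of modulus between 2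
  and 3 separate 0, 1, -1 from the others, so there every gap has exact order \<open>|x|^4\<close>,
  and a twist may move the graphs by that order. Further in, the half turn is \<open>y\<close> to
  \<open>- y\<close>, and all heights are even in \<open>y\<close>: the graphs stay put while the
  planes \<open>y = x\<close> and \<open>y = - x\<close> change places. The plane
  \<open>y = 16 x\<close> lies outside and is the reference against which the sign of
  \<open>p / q\<close> is measured. No linking number is computed. On small neighbourhoods, the
  nonvanishing functions off the third graph modulo squares form \<open>Z/2\<close>, and signs of
  square roots along the other two graphs record the parity. Since a homeomorphism only respects the
  union of the sheets, it must also be shown that it permutes them, and in which way.\<close>

definition conic_form :: "complex \<Rightarrow> complex \<Rightarrow> complex" where
  "conic_form x y = y\<^sup>2 + 16 * x\<^sup>2"

definition cross_form :: "complex \<Rightarrow> complex \<Rightarrow> complex" where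
  "cross_form x y = 17 * x * y"

fun height :: "nat \<Rightarrow> complex \<Rightarrow> complex \<Rightarrow> complex" where
  "height 0 x y = 0"
| "height (Suc 0) x y = (conic_form x y)\<^sup>2 - (cross_form x y)\<^sup>2"
| "height (Suc (Suc _)) x y = (conic_form x y)\<^sup>2"

definition eqn :: "complex \<Rightarrow> nat \<Rightarrow> complex ^ 3 \<Rightarrow> complex" where
  "eqn s i v = (if i < 3 then v $ 3 - height i (v $ 1) (v $ 2)
     else if i = 3 then v $ 2 - 16 * v $ 1 else v $ 2 - s * v $ 1)"

definition surface :: "complex \<Rightarrow> (complex ^ 3) set" where
  "surface s = {v. \<exists>i<5. eqn s i v = 0}"

lemma height_1: "height 1 x y = (conic_form x y)\<^sup>2 - (cross_form x y)\<^sup>2"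
  and height_2: "height 2 x y = (conic_form x y)\<^sup>2"
  by (simp_all add: numeral_2_eq_2)

lemma less_3_cases: "k < 3 \<Longrightarrow> k = 0 \<or> k = 1 \<or> k = (2::nat)"
  by auto

section \<open>The half twist of slopes\<close>

text \<open>For \<open>x = 0\<close> the division by zero yields the angle \<open>0\<close>, as wanted for steep slopes.\<close>

definition angle :: "complex \<Rightarrow> complex \<Rightarrow> real" where
  "angle x y = max 0 (min 1 ((3 * cmod x - cmod y) / cmod x))"

text \<open>The rotation keeps the modulus of \<open>y\<close>, and \<open>angle\<close> depends on
  moduli only; hence the twists for \<open>e\<close> and \<open>- e\<close> invert each other. The
  parameter \<open>e\<close> lets one definition serve both directions.\<close>

definition rot :: "real \<Rightarrow> complex \<Rightarrow> complex \<Rightarrow> complex" where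
  "rot e x y = y * cis (e * pi * angle x y)"

lemma cmod_rot [simp]: "cmod (rot e x y) = cmod y"
  by (simp add: rot_def norm_mult)

lemma angle_rot [simp]: "angle x (rot e x y) = angle x y"
  by (simp add: angle_def)

lemma rot_rot [simp]: "rot (- e) x (rot e x y) = y"
proof -
  have "rot (- e) x (rot e x y) = y * (cis (e * pi * angle x y) * cis (- e * pi * angle x y))"
    unfolding rot_def[of "- e"] angle_rot unfolding rot_def by (simp add: mult.assoc)
  also have "\<dots> = y" by (simp add: cis_mult)
  finally show ?thesis .
qed

lemma angle_outer: "3 * cmod x \<le> cmod y \<Longrightarrow> angle x y = 0"
  using divide_nonpos_nonneg[of "3 * cmod x - cmod y" "cmod x"] by (simp add: angle_def)

lemma angle_inner: "cmod y \<le> 2 * cmod x \<Longrightarrow> x \<noteq> 0 \<Longrightarrow> angle x y = 1"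
  by (auto simp: angle_def max_def min_def field_simps)

lemma rot_outer: "3 * cmod x \<le> cmod y \<Longrightarrow> rot e x y = y"
  by (simp add: rot_def angle_outer)

lemma rot_inner:
  assumes "cmod y \<le> 2 * cmod x" "\<bar>e\<bar> = 1"
  shows "rot e x y = - y"
proof (cases "x = 0")
  case True
  then show ?thesis using assms by (simp add: rot_def)
next
  case False
  have "e = 1 \<or> e = - 1" using assms(2) by linarith
  then show ?thesis using angle_inner[OF assms(1) False]
    by (auto simp: rot_def cis.ctr complex_eq_iff)
qed

text \<open>The angle is homogeneous of degree 0, so its Lipschitz constant near a point is of order
  \<open>1 / |x|\<close>. The weight \<open>|y|\<close>, at most \<open>3 |x|\<close>, compensates
  for this.\<close>

lemma angle_lipschitz:
  assumes "cmod y \<le> 3 * cmod x"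
  shows "cmod y * \<bar>angle x y - angle x' y'\<bar> \<le> 18 * (cmod (x - x') + cmod (y - y'))"
proof -
  define a b a' b' where ab: "a = cmod x" "b = cmod y" "a' = cmod x'" "b' = cmod y'"
  have nn: "a \<ge> 0" "b \<ge> 0" "a' \<ge> 0" "b' \<ge> 0" by (auto simp: ab)
  have b3: "b \<le> 3 * a" using assms by (simp add: ab)
  have da: "\<bar>a - a'\<bar> \<le> cmod (x - x')" and db: "\<bar>b - b'\<bar> \<le> cmod (y - y')"
    by (simp_all add: ab norm_triangle_ineq3)
  have unit: "\<bar>angle x y - angle x' y'\<bar> \<le> 1"
    by (auto simp: angle_def max_def min_def)
  consider "a = 0" | "a > 0" "a' < a / 2" | "a > 0" "a' \<ge> a / 2" using nn by linarith
  then have "b * \<bar>angle x y - angle x' y'\<bar> \<le> 18 * (\<bar>a - a'\<bar> + \<bar>b - b'\<bar>)"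
  proof cases
    case 1
    then have "b = 0" using b3 nn by simp
    then show ?thesis by simp
  next
    \<comment> \<open>The modulus of \<open>x\<close> drops by more than half, so the distance of
      the points is already comparable to \<open>b\<close> and the trivial bound 1 on the angles is
      enough.\<close>
    case 2
    have "b * \<bar>angle x y - angle x' y'\<bar> \<le> b * 1"
      using unit nn by (intro mult_left_mono) auto
    also have "b * 1 \<le> 6 * (a - a')" using 2 b3 by simp
    also have "\<dots> \<le> 18 * (\<bar>a - a'\<bar> + \<bar>b - b'\<bar>)" by (simp add: abs_if)
    finally show ?thesis .
  next
    \<comment> \<open>Clamping to \<open>[0, 1]\<close> does not increase differences, and
      \<open>b \<le> 3 * a \<le> 6 * a'\<close> cancels the denominator \<open>a'\<close>.\<close>
    case 3
    then have a': "a' > 0" by linarith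
    have "\<bar>angle x y - angle x' y'\<bar> \<le> \<bar>(3 * a - b) / a - (3 * a' - b') / a'\<bar>"
      unfolding angle_def ab[symmetric] by (auto simp: max_def min_def)
    also have "(3 * a - b) / a - (3 * a' - b') / a' = ((b' - b) * a + b * (a - a')) / (a * a')"
      using 3 a' by (simp add: field_simps)
    also have "\<bar>\<dots>\<bar> = \<bar>(b' - b) * a + b * (a - a')\<bar> / (a * a')"
      using 3 a' by (simp add: abs_divide)
    finally have "b * \<bar>angle x y - angle x' y'\<bar> \<le> b * (\<bar>(b' - b) * a + b * (a - a')\<bar> / (a * a'))"
      using nn by (intro mult_left_mono)
    also have "\<dots> \<le> 6 * a' * (\<bar>(b' - b) * a + b * (a - a')\<bar> / (a * a'))"
      using 3 b3 a' by (intro mult_right_mono divide_nonneg_nonneg) auto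
    also have "\<dots> = 6 * \<bar>(b' - b) * a + b * (a - a')\<bar> / a"
      using 3 a' by simp
    also have "\<dots> \<le> 6 * (\<bar>b' - b\<bar> * a + (3 * a) * \<bar>a - a'\<bar>) / a"
    proof (intro divide_right_mono mult_left_mono)
      have "\<bar>(b' - b) * a + b * (a - a')\<bar> \<le> \<bar>(b' - b) * a\<bar> + \<bar>b * (a - a')\<bar>"
        by (rule abs_triangle_ineq)
      also have "\<dots> = \<bar>b' - b\<bar> * a + b * \<bar>a - a'\<bar>" using nn by (simp add: abs_mult)
      also have "\<dots> \<le> \<bar>b' - b\<bar> * a + (3 * a) * \<bar>a - a'\<bar>"
        using b3 by (intro add_left_mono mult_right_mono) auto
      finally show "\<bar>(b' - b) * a + b * (a - a')\<bar> \<le> \<bar>b' - b\<bar> * a + (3 * a) * \<bar>a - a'\<bar>" .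
    qed (use 3 in auto)
    also have "\<dots> = 6 * \<bar>b - b'\<bar> + 18 * \<bar>a - a'\<bar>"
      using 3 by (simp add: field_simps abs_minus_commute)
    finally show ?thesis by (rule order_trans) (simp add: abs_if)
  qed
  then show ?thesis using da db by (simp add: ab(2))
qed

text \<open>A chord is no longer than its arc: the left side is
  \<open>2 |sin ((a - b) / 2)|\<close>.\<close>

lemma cmod_cis_diff_le: "cmod (cis a - cis b) \<le> \<bar>a - b\<bar>"
proof -
  have "(cmod (cis a - cis b))\<^sup>2 = 2 - 2 * cos (a - b)"
    using sin_cos_squared_add[of a] sin_cos_squared_add[of b]
    unfolding cmod_power2 by (simp add: power2_eq_square algebra_simps cos_diff)
  also have "\<dots> = (2 * sin ((a - b) / 2))\<^sup>2"
    using cos_double_sin[of "(a - b) / 2"] unfolding power2_eq_square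
    by (simp only: nonzero_mult_div_cancel_left times_divide_eq_right) (simp add: power2_eq_square)
  also have "\<dots> \<le> \<bar>a - b\<bar>\<^sup>2"
    using abs_sin_x_le_abs_x[of "(a - b) / 2"] by (subst abs_le_square_iff[symmetric]) auto
  finally show ?thesis using abs_le_square_iff[of "cmod (cis a - cis b)" "\<bar>a - b\<bar>"] by simp
qed

text \<open>The rotation factor varies like the angle, which is controlled with weight
  \<open>|y|\<close> at a point of slope at most 3. One such point among the two is enough; if there
  is none, the map is the identity at both. The constant leaves room for \<open>4 * 18 + 1\<close>,
  with 4 bounding \<open>pi\<close>.\<close>

lemma rot_lipschitz:
  assumes "\<bar>e\<bar> = 1"
  shows "cmod (rot e x y - rot e x' y') \<le> 100 * (cmod (x - x') + cmod (y - y'))"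
proof -
  have *: "cmod (rot e x y - rot e x' y') \<le> 100 * (cmod (x - x') + cmod (y - y'))"
    if "cmod y \<le> 3 * cmod x" for x y x' y'
  proof -
    let ?E = "cis (e * pi * angle x y)" and ?E' = "cis (e * pi * angle x' y')"
    have "rot e x y - rot e x' y' = y * (?E - ?E') + (y - y') * ?E'"
      by (simp add: rot_def algebra_simps)
    then have "cmod (rot e x y - rot e x' y') \<le> cmod y * cmod (?E - ?E') + cmod (y - y')"
      by (metis norm_triangle_ineq norm_mult norm_cis mult.right_neutral)
    moreover have "cmod y * cmod (?E - ?E') \<le> cmod y * (4 * \<bar>angle x y - angle x' y'\<bar>)"
    proof (rule mult_left_mono)
      have "cmod (?E - ?E') \<le> \<bar>e * pi * angle x y - e * pi * angle x' y'\<bar>"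
        by (rule cmod_cis_diff_le)
      also have "\<dots> = pi * \<bar>angle x y - angle x' y'\<bar>"
        using assms by (simp add: abs_mult mult.assoc flip: right_diff_distrib)
      also have "\<dots> \<le> 4 * \<bar>angle x y - angle x' y'\<bar>"
        using pi_less_4 by (intro mult_right_mono) auto
      finally show "cmod (?E - ?E') \<le> 4 * \<bar>angle x y - angle x' y'\<bar>" .
    qed simp
    moreover have "cmod y * (4 * \<bar>angle x y - angle x' y'\<bar>) \<le> 72 * (cmod (x - x') + cmod (y - y'))"
      using angle_lipschitz[OF that, of x' y'] by simp
    moreover have "0 \<le> cmod (x - x')" by simp
    ultimately show ?thesis using norm_ge_zero[of "y - y'"] unfolding distrib_left by linarith
  qed
  consider "cmod y \<le> 3 * cmod x" | "cmod y' \<le> 3 * cmod x'"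
    | "3 * cmod x \<le> cmod y" "3 * cmod x' \<le> cmod y'" by linarith
  then show ?thesis
  proof cases
    case 1 then show ?thesis by (rule *)
  next
    case 2 then show ?thesis using *[OF 2, of x y] by (simp add: norm_minus_commute)
  next
    case 3
    then have "cmod (rot e x y - rot e x' y') = cmod (y - y')" by (simp add: rot_outer)
    moreover have "0 \<le> cmod (x - x')" "0 \<le> cmod (y - y')" by auto
    ultimately show ?thesis unfolding distrib_left by linarith
  qed
qed

text \<open>The bound on the values is built in because boundedness is what makes Lipschitz
  functions closed under products.\<close>

definition lipschitz_bidisc :: "(complex \<Rightarrow> complex \<Rightarrow> complex) \<Rightarrow> bool" where
  "lipschitz_bidisc f \<longleftrightarrow> (\<exists>K. \<forall>x y x' y'. cmod x < 1 \<and> cmod y < 1 \<and> cmod x' < 1 \<and> cmod y' < 1 \<longrightarrow>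
     cmod (f x y) \<le> K \<and> cmod (f x y - f x' y') \<le> K * (cmod (x - x') + cmod (y - y')))"

lemma lipschitz_bidisc_fst: "lipschitz_bidisc (\<lambda>x y. x)"
  and lipschitz_bidisc_snd: "lipschitz_bidisc (\<lambda>x y. y)"
  and lipschitz_bidisc_const: "lipschitz_bidisc (\<lambda>x y. c)"
  unfolding lipschitz_bidisc_def
  by ((rule exI[of _ 1], auto)[1], (rule exI[of _ 1], auto)[1], rule exI[of _ "cmod c"], auto)

lemma lipschitz_bidisc_add:
  assumes "lipschitz_bidisc f" "lipschitz_bidisc g"
  shows "lipschitz_bidisc (\<lambda>x y. f x y + g x y)"
proof -
  obtain K where K: "\<And>x y x' y'. cmod x < 1 \<Longrightarrow> cmod y < 1 \<Longrightarrow> cmod x' < 1 \<Longrightarrow> cmod y' < 1 \<Longrightarrow>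
     cmod (f x y) \<le> K \<and> cmod (f x y - f x' y') \<le> K * (cmod (x - x') + cmod (y - y'))"
    using assms(1) unfolding lipschitz_bidisc_def by blast
  obtain L where L: "\<And>x y x' y'. cmod x < 1 \<Longrightarrow> cmod y < 1 \<Longrightarrow> cmod x' < 1 \<Longrightarrow> cmod y' < 1 \<Longrightarrow>
     cmod (g x y) \<le> L \<and> cmod (g x y - g x' y') \<le> L * (cmod (x - x') + cmod (y - y'))"
    using assms(2) unfolding lipschitz_bidisc_def by blast
  show ?thesis unfolding lipschitz_bidisc_def
  proof (rule exI[of _ "K + L"], intro allI impI conjI)
    fix x y x' y' assume "cmod x < 1 \<and> cmod y < 1 \<and> cmod x' < 1 \<and> cmod y' < 1"
    then have *: "cmod (f x y) \<le> K" "cmod (f x y - f x' y') \<le> K * (cmod (x - x') + cmod (y - y'))"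
      "cmod (g x y) \<le> L" "cmod (g x y - g x' y') \<le> L * (cmod (x - x') + cmod (y - y'))"
      using K L by blast+
    show "cmod (f x y + g x y) \<le> K + L"
      using norm_triangle_ineq[of "f x y" "g x y"] * by linarith
    show "cmod (f x y + g x y - (f x' y' + g x' y')) \<le> (K + L) * (cmod (x - x') + cmod (y - y'))"
      unfolding distrib_right[of K L] add_diff_add
      using norm_triangle_ineq[of "f x y - f x' y'" "g x y - g x' y'"] * by linarith
  qed
qed

lemma lipschitz_bidisc_mult:
  assumes "lipschitz_bidisc f" "lipschitz_bidisc g"
  shows "lipschitz_bidisc (\<lambda>x y. f x y * g x y)"
proof -
  obtain K where K: "\<And>x y x' y'. cmod x < 1 \<Longrightarrow> cmod y < 1 \<Longrightarrow> cmod x' < 1 \<Longrightarrow> cmod y' < 1 \<Longrightarrow>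
     cmod (f x y) \<le> K \<and> cmod (f x y - f x' y') \<le> K * (cmod (x - x') + cmod (y - y'))"
    using assms(1) unfolding lipschitz_bidisc_def by blast
  obtain L where L: "\<And>x y x' y'. cmod x < 1 \<Longrightarrow> cmod y < 1 \<Longrightarrow> cmod x' < 1 \<Longrightarrow> cmod y' < 1 \<Longrightarrow>
     cmod (g x y) \<le> L \<and> cmod (g x y - g x' y') \<le> L * (cmod (x - x') + cmod (y - y'))"
    using assms(2) unfolding lipschitz_bidisc_def by blast
  have "cmod (f 0 0) \<le> K" "cmod (g 0 0) \<le> L" using K[of 0 0 0 0] L[of 0 0 0 0] by auto
  then have KL: "0 \<le> K" "0 \<le> L" using norm_ge_zero order_trans by blast+
  show ?thesis unfolding lipschitz_bidisc_def
  proof (rule exI[of _ "2 * K * L"], intro allI impI conjI)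
    fix x y x' y' assume h: "cmod x < 1 \<and> cmod y < 1 \<and> cmod x' < 1 \<and> cmod y' < 1"
    define N where "N = cmod (x - x') + cmod (y - y')"
    have *: "cmod (f x y) \<le> K" "cmod (f x y - f x' y') \<le> K * N"
      "cmod (g x' y') \<le> L" "cmod (g x y - g x' y') \<le> L * N" "cmod (g x y) \<le> L"
      using K L h unfolding N_def by blast+
    have "cmod (f x y) * cmod (g x y) \<le> K * L" using * KL by (intro mult_mono) auto
    then show "cmod (f x y * g x y) \<le> 2 * K * L" using mult_nonneg_nonneg[OF KL] by (simp add: norm_mult)
    have "f x y * g x y - f x' y' * g x' y' = f x y * (g x y - g x' y') + (f x y - f x' y') * g x' y'"
      by (simp add: algebra_simps)
    then have "cmod (f x y * g x y - f x' y' * g x' y')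
        \<le> cmod (f x y) * cmod (g x y - g x' y') + cmod (f x y - f x' y') * cmod (g x' y')"
      by (metis norm_triangle_ineq norm_mult)
    also have "\<dots> \<le> K * (L * N) + (K * N) * L"
      using * KL by (intro add_mono mult_mono) (auto simp: N_def)
    finally show "cmod (f x y * g x y - f x' y' * g x' y') \<le> 2 * K * L * (cmod (x - x') + cmod (y - y'))"
      unfolding N_def by (simp add: algebra_simps)
  qed
qed

lemma lipschitz_bidisc_height: "lipschitz_bidisc (height k)"
proof -
  have eq: "height k = (\<lambda>x y. if k = 0 then 0 else if k = 1 then
     (y * y + 16 * (x * x)) * (y * y + 16 * (x * x)) + (- 289) * ((x * y) * (x * y))
     else (y * y + 16 * (x * x)) * (y * y + 16 * (x * x)))"
    by (intro ext, cases "(k, 0::complex, 0::complex)" rule: height.cases)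
      (auto simp: conic_form_def cross_form_def power2_eq_square algebra_simps)
  note intros = lipschitz_bidisc_fst lipschitz_bidisc_snd lipschitz_bidisc_const
    lipschitz_bidisc_add lipschitz_bidisc_mult
  consider "k = 0" | "k = 1" | "k \<noteq> 0" "k \<noteq> 1" by blast
  then show ?thesis
    unfolding eq by cases (simp_all only: if_True if_False if_not_P simp_thms one_neq_zero, (intro intros)+)
qed

section \<open>Gaps between the graphs over the annulus of slopes\<close>

definition in_annulus :: "complex \<Rightarrow> complex \<Rightarrow> bool" where
  "in_annulus x y \<longleftrightarrow> 2 * cmod x < cmod y \<and> cmod y < 3 * cmod x"

lemma height_uminus: "height k x (- y) = height k x y"
  by (cases "(k, x, y)" rule: height.cases) (auto simp: conic_form_def cross_form_def)

text \<open>Off the annulus the twist is \<open>y\<close> or \<open>- y\<close>, and every height is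
  even in \<open>y\<close>.\<close>

lemma height_rot:
  assumes "\<not> in_annulus x y" "\<bar>e\<bar> = 1"
  shows "height k x (rot e x y) = height k x y"
  using assms rot_inner[OF _ assms(2), of y x] rot_outer[of x y e]
  by (auto simp: in_annulus_def not_less height_uminus)

text \<open>The three gaps are \<open>p^2\<close>, \<open>q^2\<close> and
  \<open>p^2 - q^2 = (y^2 - 256 x^2) (y^2 - x^2)\<close>. In units of \<open>|x|^2\<close>, the
  annulus gives at least 7 for \<open>|p|\<close>, 34 for \<open>|q|\<close>, and 247 and 3 for the
  two factors; the constant 1 is a crude common bound.\<close>

lemma height_diff_lower:
  assumes "in_annulus x y" "k < 3" "l < 3" "k \<noteq> l"
  shows "cmod (height k x y - height l x y) \<ge> cmod x ^ 4"
proof -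
  define a b where ab: "a = cmod x" "b = cmod y"
  have R: "2 * a < b" "b < 3 * a" using assms(1) by (auto simp: in_annulus_def ab)
  have a0: "a > 0" using R by linarith
  have a2: "(2 * a)\<^sup>2 \<le> b\<^sup>2" "b\<^sup>2 \<le> (3 * a)\<^sup>2" using R a0 by (intro power_mono; simp)+
  have a4: "a ^ 4 = a\<^sup>2 * a\<^sup>2" by (simp add: power_add[symmetric])
  have c: "7 * a\<^sup>2 \<le> cmod (conic_form x y)"
  proof -
    have "cmod (16 * x\<^sup>2) - cmod (- (y\<^sup>2)) \<le> cmod (16 * x\<^sup>2 - - (y\<^sup>2))" by (rule norm_triangle_ineq2)
    then show ?thesis using a2
      by (simp add: conic_form_def norm_mult norm_power ab power_mult_distrib add.commute)
  qed
  have q: "34 * a\<^sup>2 \<le> cmod (cross_form x y)"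
    using R(1) a0 unfolding cross_form_def norm_mult ab[symmetric] by (simp add: power2_eq_square)
  have n: "0 \<le> a\<^sup>2 * a\<^sup>2" by simp
  have 2: "a ^ 4 \<le> cmod ((conic_form x y)\<^sup>2)"
  proof -
    have "a ^ 4 \<le> (7 * a\<^sup>2)\<^sup>2" using n unfolding a4 power2_eq_square[of "7 * a\<^sup>2"] by linarith
    also have "\<dots> \<le> (cmod (conic_form x y))\<^sup>2" by (rule power_mono[OF c]) simp
    finally show ?thesis by (simp add: norm_power)
  qed
  have 3: "a ^ 4 \<le> cmod ((cross_form x y)\<^sup>2)"
  proof -
    have "a ^ 4 \<le> (34 * a\<^sup>2)\<^sup>2" using n unfolding a4 power2_eq_square[of "34 * a\<^sup>2"] by linarith
    also have "\<dots> \<le> (cmod (cross_form x y))\<^sup>2" by (rule power_mono[OF q]) simp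
    finally show ?thesis by (simp add: norm_power)
  qed
  have 1: "a ^ 4 \<le> cmod ((conic_form x y)\<^sup>2 - (cross_form x y)\<^sup>2)"
  proof -
    have eq: "(conic_form x y)\<^sup>2 - (cross_form x y)\<^sup>2 = (y\<^sup>2 - 256 * x\<^sup>2) * (y\<^sup>2 - x\<^sup>2)"
      by (simp add: conic_form_def cross_form_def power2_eq_square algebra_simps)
    have "cmod (256 * x\<^sup>2) - cmod (y\<^sup>2) \<le> cmod (y\<^sup>2 - 256 * x\<^sup>2)"
      using norm_triangle_ineq2[of "256 * x\<^sup>2" "y\<^sup>2"] by (simp add: norm_minus_commute)
    then have u: "a\<^sup>2 \<le> cmod (y\<^sup>2 - 256 * x\<^sup>2)"
      using a2 by (simp add: norm_mult norm_power ab power_mult_distrib)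
    have "cmod (y\<^sup>2) - cmod (x\<^sup>2) \<le> cmod (y\<^sup>2 - x\<^sup>2)" by (rule norm_triangle_ineq2)
    then have v: "a\<^sup>2 \<le> cmod (y\<^sup>2 - x\<^sup>2)"
      using a2 by (simp add: norm_mult norm_power ab power_mult_distrib)
    show ?thesis unfolding eq norm_mult a4 by (rule mult_mono[OF u v]) auto
  qed
  show ?thesis
    using less_3_cases[OF assms(2)] less_3_cases[OF assms(3)] assms(4) 1 2 3
    by (elim disjE) (simp_all add: height_1 height_2 ab norm_minus_commute)
qed

text \<open>In units of \<open>|x|^2\<close>, \<open>|p|\<close> is at most
  \<open>9 + 16 = 25\<close> and \<open>|q|\<close> at most \<open>17 * 3 = 51\<close>; 4000 rounds
  up \<open>625 + 2601\<close>.\<close>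

lemma height_upper:
  assumes "in_annulus x y"
  shows "cmod (height k x y) \<le> 4000 * cmod x ^ 4"
proof -
  define a b where ab: "a = cmod x" "b = cmod y"
  have R: "2 * a < b" "b < 3 * a" using assms(1) by (auto simp: in_annulus_def ab)
  have a0: "a > 0" using R by linarith
  have a2: "b\<^sup>2 \<le> (3 * a)\<^sup>2" using R a0 by (intro power_mono; simp)
  have a4: "a ^ 4 = a\<^sup>2 * a\<^sup>2" by (simp add: power_add[symmetric])
  have c: "cmod (conic_form x y) \<le> 25 * a\<^sup>2"
    using norm_triangle_ineq[of "y\<^sup>2" "16 * x\<^sup>2"] a2
    by (simp add: conic_form_def norm_mult norm_power ab power_mult_distrib)
  have q: "cmod (cross_form x y) \<le> 51 * a\<^sup>2"
    using R(2) a0 unfolding cross_form_def norm_mult ab[symmetric] by (simp add: power2_eq_square)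
  have c2: "cmod ((conic_form x y)\<^sup>2) \<le> 625 * a ^ 4"
    using power_mono[OF c, of 2] by (simp add: norm_power power_mult_distrib)
  have q2: "cmod ((cross_form x y)\<^sup>2) \<le> 2601 * a ^ 4"
    using power_mono[OF q, of 2] by (simp add: norm_power power_mult_distrib)
  have n: "0 \<le> a ^ 4" using a0 by simp
  have sq: "cmod ((conic_form x y)\<^sup>2 - (cross_form x y)\<^sup>2) \<le> 4000 * a ^ 4" "cmod ((conic_form x y)\<^sup>2) \<le> 4000 * a ^ 4"
    using c2 q2 n norm_triangle_ineq4[of "(conic_form x y)\<^sup>2" "(cross_form x y)\<^sup>2"] by linarith+
  consider "k = 0" | "k = Suc 0" | l where "k = Suc (Suc l)"
    by (metis not0_implies_Suc)
  then show ?thesis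
    unfolding ab(1)[symmetric] by cases (use sq n in simp_all)
qed

text \<open>The vertical displacement that keeps a point of a graph on the same graph after its base
  point is twisted. The graph is recognised from \<open>z\<close>. This is ambiguous where graphs
  meet and meaningless on the vertical planes, but both happen only off the annulus, where the
  displacement is 0 for every choice of \<open>k\<close>.\<close>

definition shift :: "real \<Rightarrow> complex \<Rightarrow> complex \<Rightarrow> complex \<Rightarrow> complex" where
  "shift e x y z = (let k = (if z = 0 then 0 else if z = height 1 x y then 1 else 2)
     in height k x (rot e x y) - height k x y)"

lemma shift_outer: "\<not> in_annulus x y \<Longrightarrow> \<bar>e\<bar> = 1 \<Longrightarrow> shift e x y z = 0"
  by (simp add: shift_def Let_def height_rot)

lemma height_inj_annulus:
  assumes "in_annulus x y" "k < 3" "l < 3" "height k x y = height l x y"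
  shows "k = l"
proof (rule ccontr)
  assume "k \<noteq> l"
  then have "cmod x ^ 4 \<le> 0" using height_diff_lower[OF assms(1-3)] assms(4) by simp
  moreover have "cmod x > 0" using assms(1) unfolding in_annulus_def by linarith
  ultimately show False by (metis linorder_not_le zero_less_power)
qed

lemma shift_height:
  assumes "k < 3" "\<bar>e\<bar> = 1"
  shows "shift e x y (height k x y) = height k x (rot e x y) - height k x y"
proof (cases "in_annulus x y")
  case False
  then show ?thesis using assms(2) by (simp add: shift_outer height_rot)
next
  case True
  define l where "l = (if height k x y = 0 then 0 else if height k x y = height 1 x y then 1 else 2 :: nat)"
  have "l = k"
  proof -
    have "height 0 x y = height k x y \<Longrightarrow> k = 0" "height 1 x y = height k x y \<Longrightarrow> k = 1"
      using height_inj_annulus[OF True _ assms(1), of 0] height_inj_annulus[OF True _ assms(1), of 1] by simp_all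
    then show ?thesis using less_3_cases[OF assms(1)] by (auto simp: l_def)
  qed
  then show ?thesis unfolding shift_def Let_def l_def[symmetric] by simp
qed

lemma in_annulus_rot [simp]: "in_annulus x (rot e x y) = in_annulus x y"
  by (simp add: in_annulus_def)

lemma lipschitz_height_rot:
  assumes "\<bar>e\<bar> = 1"
  shows "lipschitz_bidisc (\<lambda>x y. height k x (rot e x y))"
proof -
  obtain K where K: "\<And>x y x' y'. cmod x < 1 \<Longrightarrow> cmod y < 1 \<Longrightarrow> cmod x' < 1 \<Longrightarrow> cmod y' < 1 \<Longrightarrow>
     cmod (height k x y) \<le> K \<and> cmod (height k x y - height k x' y') \<le> K * (cmod (x - x') + cmod (y - y'))"
    using lipschitz_bidisc_height[of k] unfolding lipschitz_bidisc_def by blast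
  have K0: "0 \<le> K" using K[of 0 0 0 0] norm_ge_zero order_trans by (metis norm_zero zero_less_one)
  show ?thesis unfolding lipschitz_bidisc_def
  \<comment> \<open>The twist preserves the bidisc, so \<open>K\<close> applies after it as well;
    101 is 1 for \<open>x\<close> plus 100 from \<open>rot_lipschitz\<close>.\<close>
  proof (rule exI[of _ "101 * K"], intro allI impI conjI)
    fix x y x' y' assume h: "cmod x < 1 \<and> cmod y < 1 \<and> cmod x' < 1 \<and> cmod y' < 1"
    have "cmod (height k x (rot e x y)) \<le> K" using K[of x "rot e x y" x "rot e x y"] h by simp
    then show "cmod (height k x (rot e x y)) \<le> 101 * K" using K0 by linarith
    have "cmod (height k x (rot e x y) - height k x' (rot e x' y'))
        \<le> K * (cmod (x - x') + cmod (rot e x y - rot e x' y'))"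
      using K[of x "rot e x y" x' "rot e x' y'"] h by simp
    also have "\<dots> \<le> K * (101 * (cmod (x - x') + cmod (y - y')))"
    proof (rule mult_left_mono[OF _ K0])
      show "cmod (x - x') + cmod (rot e x y - rot e x' y') \<le> 101 * (cmod (x - x') + cmod (y - y'))"
        using rot_lipschitz[OF assms, of x y x' y'] norm_ge_zero[of "y - y'"]
        unfolding distrib_left by linarith
    qed
    finally show "cmod (height k x (rot e x y) - height k x' (rot e x' y')) \<le> 101 * K * (cmod (x - x') + cmod (y - y'))"
      by (simp add: mult_ac)
  qed
qed

text \<open>On the annulus the twist moves each sheet by at most a multiple of \<open>\<bar>x\<bar>\<^sup>4\<close>, which is also the
  order of the gap between any two sheets there; off the annulus the sheets are not moved at all.\<close>

lemma shift_lipschitz: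
  assumes e: "\<bar>e\<bar> = 1" and s: "cmod s = 1"
  shows "\<exists>K\<ge>0. \<forall>v\<in>surface s. \<forall>v'\<in>surface s.
    cmod (v $ 1) < 1 \<and> cmod (v $ 2) < 1 \<and> cmod (v' $ 1) < 1 \<and> cmod (v' $ 2) < 1 \<longrightarrow>
    cmod (shift e (v $ 1) (v $ 2) (v $ 3) - shift e (v' $ 1) (v' $ 2) (v' $ 3))
      \<le> K * (cmod (v $ 1 - v' $ 1) + cmod (v $ 2 - v' $ 2) + cmod (v $ 3 - v' $ 3))"
proof -
  define dh where "dh k x y = height k x (rot e x y) - height k x y" for k x y
  have "\<exists>K\<ge>0. \<forall>k<3. \<forall>x y x' y'. cmod x < 1 \<and> cmod y < 1 \<and> cmod x' < 1 \<and> cmod y' < 1 \<longrightarrow>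
      cmod (f k x y - f k x' y') \<le> K * (cmod (x - x') + cmod (y - y'))"
    if "\<And>k. lipschitz_bidisc (f k)" for f :: "nat \<Rightarrow> complex \<Rightarrow> complex \<Rightarrow> complex"
  proof -
    have "\<forall>k. \<exists>K. \<forall>x y x' y'. cmod x < 1 \<and> cmod y < 1 \<and> cmod x' < 1 \<and> cmod y' < 1 \<longrightarrow>
      cmod (f k x y) \<le> K \<and> cmod (f k x y - f k x' y') \<le> K * (cmod (x - x') + cmod (y - y'))"
      using that unfolding lipschitz_bidisc_def by blast
    then obtain K where K: "\<And>k x y x' y'. cmod x < 1 \<Longrightarrow> cmod y < 1 \<Longrightarrow> cmod x' < 1 \<Longrightarrow> cmod y' < 1 \<Longrightarrow>
      cmod (f k x y - f k x' y') \<le> K k * (cmod (x - x') + cmod (y - y'))"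
      by metis
    have le: "K k * (cmod (x - x') + cmod (y - y')) \<le> \<bar>Max (K ` {..<3})\<bar> * (cmod (x - x') + cmod (y - y'))"
      if "k < 3" for k x y x' y'
      using that by (intro mult_right_mono order_trans[OF Max_ge abs_ge_self]) auto
    show ?thesis
    proof (intro exI[of _ "\<bar>Max (K ` {..<3})\<bar>"] conjI allI impI)
      fix k x y x' y' assume "k < (3::nat)" "cmod x < 1 \<and> cmod y < 1 \<and> cmod x' < 1 \<and> cmod y' < 1"
      then show "cmod (f k x y - f k x' y') \<le> \<bar>Max (K ` {..<3})\<bar> * (cmod (x - x') + cmod (y - y'))"
        using K le[of k] order_trans by blast
    qed simp
  qed
  note uniform = this
  have "lipschitz_bidisc (dh k)" for k
    using lipschitz_bidisc_add[OF lipschitz_height_rot[OF e, of k]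
        lipschitz_bidisc_mult[OF lipschitz_bidisc_const[of "-1"] lipschitz_bidisc_height[of k]]]
    by (simp add: dh_def[abs_def])
  from uniform[of dh, OF this] obtain K where K0: "0 \<le> K" and K: "\<And>k x y x' y'. k < 3 \<Longrightarrow> cmod x < 1 \<Longrightarrow> cmod y < 1 \<Longrightarrow>
      cmod x' < 1 \<Longrightarrow> cmod y' < 1 \<Longrightarrow>
      cmod (dh k x y - dh k x' y') \<le> K * (cmod (x - x') + cmod (y - y'))"
    by blast
  from uniform[of height, OF lipschitz_bidisc_height] obtain L where
    L0: "0 \<le> L" and L: "\<And>k x y x' y'. k < 3 \<Longrightarrow> cmod x < 1 \<Longrightarrow> cmod y < 1 \<Longrightarrow> cmod x' < 1 \<Longrightarrow> cmod y' < 1 \<Longrightarrow>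
      cmod (height k x y - height k x' y') \<le> L * (cmod (x - x') + cmod (y - y'))"
    by blast
  define M where "M = K + 16000 * (L + 1)"
  \<comment> \<open>Over one base point, a change of graph alters the displacement by at most four
    heights, each below \<open>4000 |x|^4\<close>, while the gap itself is at least
    \<open>|x|^4\<close>.\<close>
  have gap: "cmod (dh k x y - dh l x y) \<le> 16000 * cmod (height k x y - height l x y)"
    if "k < 3" "l < 3" for k l x y
  proof (cases "in_annulus x y \<and> k \<noteq> l")
    case False
    then show ?thesis using e by (auto simp: dh_def height_rot)
  next
    case True
    then have A: "in_annulus x y" "in_annulus x (rot e x y)" by auto
    have "cmod (dh k x y - dh l x y) \<le> cmod (dh k x y) + cmod (dh l x y)" by (rule norm_triangle_ineq4)
    also have "\<dots> \<le> (cmod (height k x (rot e x y)) + cmod (height k x y))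
        + (cmod (height l x (rot e x y)) + cmod (height l x y))"
      unfolding dh_def by (intro add_mono norm_triangle_ineq4)
    also have "\<dots> \<le> 16000 * cmod x ^ 4"
      using height_upper[OF A(1), of k] height_upper[OF A(2), of k]
        height_upper[OF A(1), of l] height_upper[OF A(2), of l] by simp
    also have "\<dots> \<le> 16000 * cmod (height k x y - height l x y)"
      using height_diff_lower[OF A(1) that] True by simp
    finally show ?thesis .
  qed
  \<comment> \<open>The base point is moved first with the graph fixed, and then the graph is
    changed over the new base point. The gap there is at most the given vertical distance plus the
    variation of a height.\<close>
  have sheet: "cmod (dh k x y - dh l x' y')
      \<le> M * (cmod (x - x') + cmod (y - y') + cmod (height k x y - height l x' y'))"
    if "k < 3" "l < 3" "cmod x < 1" "cmod y < 1" "cmod x' < 1" "cmod y' < 1" for k l x y x' y'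
  proof -
    define N where "N = cmod (x - x') + cmod (y - y')"
    define D where "D = cmod (height k x y - height l x' y')"
    have N0: "0 \<le> N" "0 \<le> D" by (auto simp: N_def D_def)
    have "cmod (dh k x y - dh l x' y') \<le> cmod (dh k x y - dh k x' y') + cmod (dh k x' y' - dh l x' y')"
      by (rule norm_diff_triangle_le) auto
    moreover have "cmod (dh k x y - dh k x' y') \<le> K * N" unfolding N_def by (rule K) (use that in auto)
    moreover have "cmod (height k x' y' - height l x' y')
       \<le> cmod (height k x' y' - height k x y) + cmod (height k x y - height l x' y')"
      by (rule norm_diff_triangle_le) auto
    moreover have "cmod (height k x' y' - height k x y) \<le> L * N"
      using L[of k x y x' y'] that by (simp add: N_def norm_minus_commute)
    ultimately have "cmod (dh k x y - dh l x' y') \<le> K * N + 16000 * (L * N + D)"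
      using gap[OF that(1,2), of x' y'] unfolding D_def distrib_left by linarith
    also have "\<dots> \<le> M * (N + D)"
      unfolding M_def using N0 K0 L0 by (simp add: algebra_simps)
    finally show ?thesis by (simp add: N_def D_def)
  qed
  \<comment> \<open>At a base point off the annulus the displacement of every graph is 0, so it may
    be compared along graph \<open>k\<close> whichever sheet the second point lies on.\<close>
  have outer: "cmod (dh k x y) \<le> M * (cmod (x - x') + cmod (y - y') + D)"
    if "k < 3" "\<not> in_annulus x' y'" "cmod x < 1" "cmod y < 1" "cmod x' < 1" "cmod y' < 1" "D \<ge> 0"
    for k x y x' y' D
  proof -
    have "dh k x' y' = 0" using that(2) e by (simp add: dh_def height_rot)
    then have "cmod (dh k x y) \<le> K * (cmod (x - x') + cmod (y - y'))" using K[of k x y x' y'] that by simp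
    also have "\<dots> \<le> M * (cmod (x - x') + cmod (y - y') + D)"
      unfolding M_def using that(7) K0 L0 by (intro mult_mono) auto
    finally show ?thesis .
  qed
  \<comment> \<open>The vertical planes have slopes of modulus 16 and 1, so a point over the annulus
    must lie on a graph.\<close>
  have pts: "(\<exists>k<3. v $ 3 = height k (v $ 1) (v $ 2)) \<or> \<not> in_annulus (v $ 1) (v $ 2)"
    if v: "v \<in> surface s" for v
  proof -
    obtain i where i: "i < 5" "eqn s i v = 0" using v by (auto simp: surface_def)
    consider "i < 3" | "i = 3" | "i = 4" using i(1) by linarith
    then show ?thesis
    proof cases
      case 1
      then show ?thesis using i by (auto simp: eqn_def)
    next
      case 2
      then show ?thesis using i by (auto simp: eqn_def in_annulus_def norm_mult)
    next
      case 3
      then show ?thesis using i s by (auto simp: eqn_def in_annulus_def norm_mult)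
    qed
  qed
  show ?thesis
  proof (intro exI[of _ M] conjI ballI impI)
    show "0 \<le> M" using K0 L0 by (simp add: M_def)
    fix v v' assume vv: "v \<in> surface s" "v' \<in> surface s"
      and "cmod (v $ 1) < 1 \<and> cmod (v $ 2) < 1 \<and> cmod (v' $ 1) < 1 \<and> cmod (v' $ 2) < 1"
    then have bd: "cmod (v $ 1) < 1" "cmod (v $ 2) < 1" "cmod (v' $ 1) < 1" "cmod (v' $ 2) < 1" by auto
    consider k l where "k < 3" "l < 3" "v $ 3 = height k (v $ 1) (v $ 2)" "v' $ 3 = height l (v' $ 1) (v' $ 2)"
      | k where "k < 3" "v $ 3 = height k (v $ 1) (v $ 2)" "\<not> in_annulus (v' $ 1) (v' $ 2)"
      | k where "k < 3" "v' $ 3 = height k (v' $ 1) (v' $ 2)" "\<not> in_annulus (v $ 1) (v $ 2)"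
      | "\<not> in_annulus (v $ 1) (v $ 2)" "\<not> in_annulus (v' $ 1) (v' $ 2)"
      using pts[OF vv(1)] pts[OF vv(2)] by blast
    then show "cmod (shift e (v $ 1) (v $ 2) (v $ 3) - shift e (v' $ 1) (v' $ 2) (v' $ 3))
      \<le> M * (cmod (v $ 1 - v' $ 1) + cmod (v $ 2 - v' $ 2) + cmod (v $ 3 - v' $ 3))"
    proof cases
      case (1 k l)
      then show ?thesis
        using sheet[OF 1(1,2) bd] by (simp add: shift_height e flip: dh_def)
    next
      case (2 k)
      then show ?thesis
        using outer[OF 2(1,3) bd, of "cmod (v $ 3 - v' $ 3)"] by (simp add: shift_height shift_outer e flip: dh_def)
    next
      case (3 k)
      then show ?thesis
        using outer[OF 3(1,3) bd(3,4,1,2), of "cmod (v $ 3 - v' $ 3)"]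
        by (simp add: shift_height shift_outer e norm_minus_commute flip: dh_def)
    next
      case 4
      then show ?thesis using K0 L0 by (simp add: shift_outer e M_def)
    qed
  qed
qed

section \<open>The bilipschitz twist between the two surfaces\<close>

definition twist :: "real \<Rightarrow> complex ^ 3 \<Rightarrow> complex ^ 3" where
  "twist e v = vector [v $ 1, rot e (v $ 1) (v $ 2), v $ 3 + shift e (v $ 1) (v $ 2) (v $ 3)]"

lemma twist_nth [simp]:
  "twist e v $ 1 = v $ 1" "twist e v $ 2 = rot e (v $ 1) (v $ 2)"
  "twist e v $ 3 = v $ 3 + shift e (v $ 1) (v $ 2) (v $ 3)"
  by (simp_all add: twist_def)

lemma norm_vec3_le: "norm v \<le> cmod (v $ 1) + cmod (v $ 2) + cmod (v $ 3)" for v :: "complex ^ 3"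
  using L2_set_le_sum[of UNIV "\<lambda>i. norm (v $ i)"] by (simp add: norm_vec_def sum_3)

lemma twist_lipschitz:
  assumes e: "\<bar>e\<bar> = 1" and s: "cmod s = 1"
  shows "\<exists>K. K-lipschitz_on (surface s \<inter> {v. cmod (v $ 1) < 1 \<and> cmod (v $ 2) < 1}) (twist e)"
proof -
  obtain K where K: "K \<ge> 0" "\<And>v v'. v \<in> surface s \<Longrightarrow> v' \<in> surface s \<Longrightarrow>
    cmod (v $ 1) < 1 \<and> cmod (v $ 2) < 1 \<and> cmod (v' $ 1) < 1 \<and> cmod (v' $ 2) < 1 \<Longrightarrow>
    cmod (shift e (v $ 1) (v $ 2) (v $ 3) - shift e (v' $ 1) (v' $ 2) (v' $ 3))
      \<le> K * (cmod (v $ 1 - v' $ 1) + cmod (v $ 2 - v' $ 2) + cmod (v $ 3 - v' $ 3))"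
    using shift_lipschitz[OF assms] by blast
  show ?thesis
  \<comment> \<open>The coordinates contribute 1, \<open>100 * 2\<close> and
    \<open>1 + 3 * K\<close>.\<close>
  proof (rule exI[of _ "202 + 3 * K"], rule lipschitz_onI)
    fix v v' assume "v \<in> surface s \<inter> {v. cmod (v $ 1) < 1 \<and> cmod (v $ 2) < 1}"
      "v' \<in> surface s \<inter> {v. cmod (v $ 1) < 1 \<and> cmod (v $ 2) < 1}"
    then have sh: "cmod (shift e (v $ 1) (v $ 2) (v $ 3) - shift e (v' $ 1) (v' $ 2) (v' $ 3))
      \<le> K * (cmod (v $ 1 - v' $ 1) + cmod (v $ 2 - v' $ 2) + cmod (v $ 3 - v' $ 3))"
      using K(2) by blast
    define d where "d = dist v v'"
    have c: "cmod (v $ i - v' $ i) \<le> d" for i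
      using Finite_Cartesian_Product.norm_nth_le[of "v - v'" i] by (simp add: d_def dist_norm)
    have "dist (twist e v) (twist e v') \<le> cmod (v $ 1 - v' $ 1)
        + cmod (rot e (v $ 1) (v $ 2) - rot e (v' $ 1) (v' $ 2))
        + cmod ((v $ 3 - v' $ 3) + (shift e (v $ 1) (v $ 2) (v $ 3) - shift e (v' $ 1) (v' $ 2) (v' $ 3)))"
      using norm_vec3_le[of "twist e v - twist e v'"] by (simp add: dist_norm algebra_simps)
    also have "\<dots> \<le> d + 100 * (d + d) + (d + K * (d + d + d))"
    proof (intro add_mono)
      show "cmod (rot e (v $ 1) (v $ 2) - rot e (v' $ 1) (v' $ 2)) \<le> 100 * (d + d)"
        using rot_lipschitz[OF e, of "v $ 1" "v $ 2" "v' $ 1" "v' $ 2"] c[of 1] c[of 2] by simp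
      have "K * (cmod (v $ 1 - v' $ 1) + cmod (v $ 2 - v' $ 2) + cmod (v $ 3 - v' $ 3)) \<le> K * (d + d + d)"
        using K(1) c by (intro mult_left_mono add_mono) auto
      then show "cmod ((v $ 3 - v' $ 3) + (shift e (v $ 1) (v $ 2) (v $ 3) - shift e (v' $ 1) (v' $ 2) (v' $ 3)))
          \<le> d + K * (d + d + d)"
        using sh c[of 3] norm_triangle_ineq[of "v $ 3 - v' $ 3"
          "shift e (v $ 1) (v $ 2) (v $ 3) - shift e (v' $ 1) (v' $ 2) (v' $ 3)"] by linarith
    qed (rule c)
    finally show "dist (twist e v) (twist e v') \<le> (202 + 3 * K) * dist v v'"
      by (simp add: d_def algebra_simps)
  qed (use K in simp)
qed

text \<open>Each graph is carried to itself by the choice of \<open>shift\<close>, the plane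
  \<open>y = 16 x\<close> is fixed pointwise, and the half turn takes slope \<open>s\<close> to
  \<open>- s\<close>.\<close>

lemma twist_maps:
  assumes e: "\<bar>e\<bar> = 1" and s: "cmod s = 1" and v: "v \<in> surface s"
  shows "twist e v \<in> surface (- s)" and "twist (- e) (twist e v) = v"
proof -
  obtain i where i: "i < 5" "eqn s i v = 0" using v by (auto simp: surface_def)
  consider "i < 3" | "i = 3" | "i = 4" using i(1) by linarith
  then have "eqn (- s) i (twist e v) = 0 \<and> twist (- e) (twist e v) = v"
  proof cases
    case 1
    then have z: "v $ 3 = height i (v $ 1) (v $ 2)" using i(2) by (simp add: eqn_def)
    have tz: "twist e v $ 3 = height i (v $ 1) (rot e (v $ 1) (v $ 2))"
      by (simp add: z shift_height[OF 1 e])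
    have "shift (- e) (v $ 1) (rot e (v $ 1) (v $ 2)) (height i (v $ 1) (rot e (v $ 1) (v $ 2)))
        = height i (v $ 1) (v $ 2) - height i (v $ 1) (rot e (v $ 1) (v $ 2))"
      using shift_height[OF 1, of "- e" "v $ 1" "rot e (v $ 1) (v $ 2)"] e by simp
    then have "twist (- e) (twist e v) $ 3 = v $ 3"
      unfolding twist_nth(3)[of "- e"] tz unfolding twist_nth z by simp
    moreover have "twist (- e) (twist e v) $ 1 = v $ 1" "twist (- e) (twist e v) $ 2 = v $ 2"
      by simp_all
    ultimately have "twist (- e) (twist e v) = v" unfolding vec_eq_iff forall_3 by blast
    moreover have "eqn (- s) i (twist e v) = 0" unfolding eqn_def tz using 1 by simp
    ultimately show ?thesis by blast
  next
    case 2
    then have y: "v $ 2 = 16 * v $ 1" using i(2) by (simp add: eqn_def)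
    then have "rot e (v $ 1) (v $ 2) = v $ 2" "\<not> in_annulus (v $ 1) (v $ 2)"
      by (simp_all add: rot_outer norm_mult in_annulus_def)
    then show ?thesis using 2 y e
      by (simp add: eqn_def vec_eq_iff forall_3 shift_outer rot_outer norm_mult)
  next
    case 3
    then have y: "v $ 2 = s * v $ 1" using i(2) by (simp add: eqn_def)
    then have "cmod (v $ 2) = cmod (v $ 1)" using s by (simp add: norm_mult)
    then have "rot e (v $ 1) (v $ 2) = - v $ 2" "\<not> in_annulus (v $ 1) (v $ 2)"
      by (simp_all add: rot_inner e in_annulus_def)
    moreover have "\<not> in_annulus (v $ 1) (- v $ 2)" using calculation by (simp add: in_annulus_def)
    moreover have "rot (- e) (v $ 1) (- v $ 2) = v $ 2" using calculation rot_rot by metis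
    ultimately show ?thesis using 3 y e
      by (simp add: eqn_def vec_eq_iff forall_3 shift_outer)
  qed
  then show "twist e v \<in> surface (- s)" "twist (- e) (twist e v) = v"
    using i(1) by (auto simp: surface_def)
qed

lemma surface_same_outer_geometry:
  assumes s: "cmod s = 1"
  shows "same_Lipschitz_outer_geometry (surface s) (surface (- s))"
proof -
  \<comment> \<open>Only \<open>|x|\<close> and \<open>|y|\<close> are restricted. The twist
    preserves both, so it maps this neighbourhood to itself and no shrinking is required.\<close>
  define U where "U = {v :: complex ^ 3. cmod (v $ 1) < 1 \<and> cmod (v $ 2) < 1}"
  have U: "open U" "0 \<in> U"
    unfolding U_def by (intro open_Collect_conj open_Collect_less continuous_intros) auto
  obtain K where K: "K-lipschitz_on (surface s \<inter> U) (twist 1)"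
    using twist_lipschitz[of 1 s] s unfolding U_def by auto
  obtain L where L: "L-lipschitz_on (surface (- s) \<inter> U) (twist (- 1))"
    using twist_lipschitz[of "-1" "- s"] s unfolding U_def by auto
  have tU: "twist e v \<in> U \<longleftrightarrow> v \<in> U" for e v by (simp add: U_def)
  have hom: "homeomorphism (surface s \<inter> U) (surface (- s) \<inter> U) (twist 1) (twist (- 1))"
  proof (rule homeomorphismI)
    show "twist 1 ` (surface s \<inter> U) \<subseteq> surface (- s) \<inter> U"
      using twist_maps(1)[of 1 s] s tU by auto
    show "twist (- 1) ` (surface (- s) \<inter> U) \<subseteq> surface s \<inter> U"
      using twist_maps(1)[of "-1" "- s"] s tU by auto
    show "twist (- 1) (twist 1 v) = v" if "v \<in> surface s \<inter> U" for v
      using twist_maps(2)[of 1 s v] s that by auto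
    show "twist 1 (twist (- 1) v) = v" if "v \<in> surface (- s) \<inter> U" for v
      using twist_maps(2)[of "-1" "- s" v] s that by auto
  qed (use K L lipschitz_on_continuous_on in auto)
  have "twist 1 0 = 0"
    by (simp add: vec_eq_iff forall_3 rot_def shift_def)
  moreover have "(max K L)-lipschitz_on (surface s \<inter> U) (twist 1)"
    "(max K L)-lipschitz_on (surface (- s) \<inter> U) (twist (- 1))"
    using K L by (auto intro: lipschitz_on_le)
  ultimately show ?thesis
    unfolding same_Lipschitz_outer_geometry_def using U hom by blast
qed

section \<open>Homeomorphisms of arrangements of sheets\<close>

text \<open>Polynomials in two variables enter only through their restrictions to complex lines:
  finiteness of the roots there yields both connectedness and density of the nonzero set.\<close>

definition line_polynomial :: "(complex \<times> complex \<Rightarrow> complex) \<Rightarrow> bool" where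
  "line_polynomial f \<longleftrightarrow> (\<forall>a b c d. \<exists>P. \<forall>t. poly P t = f (a + t * b, c + t * d))"

lemma line_polynomial_const [intro]: "line_polynomial (\<lambda>w. k)"
  unfolding line_polynomial_def by (intro allI exI[of _ "[:k:]"]) simp

lemma line_polynomial_fst [intro]: "line_polynomial fst"
  and line_polynomial_snd [intro]: "line_polynomial snd"
proof -
  show "line_polynomial fst"
    unfolding line_polynomial_def
  proof (intro allI)
    fix a b c d :: complex
    show "\<exists>P. \<forall>t. poly P t = fst (a + t * b, c + t * d)" by (rule exI[of _ "[:a, b:]"]) simp
  qed
  show "line_polynomial snd"
    unfolding line_polynomial_def
  proof (intro allI)
    fix a b c d :: complex
    show "\<exists>P. \<forall>t. poly P t = snd (a + t * b, c + t * d)" by (rule exI[of _ "[:c, d:]"]) simp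
  qed
qed

lemma line_polynomial_add [intro]:
  "line_polynomial f \<Longrightarrow> line_polynomial g \<Longrightarrow> line_polynomial (\<lambda>w. f w + g w)"
  unfolding line_polynomial_def by (metis poly_add)

lemma line_polynomial_diff [intro]:
  "line_polynomial f \<Longrightarrow> line_polynomial g \<Longrightarrow> line_polynomial (\<lambda>w. f w - g w)"
  unfolding line_polynomial_def by (metis poly_diff)

lemma line_polynomial_mult [intro]:
  "line_polynomial f \<Longrightarrow> line_polynomial g \<Longrightarrow> line_polynomial (\<lambda>w. f w * g w)"
  unfolding line_polynomial_def by (metis poly_mult)

lemma line_polynomial_power [intro]: "line_polynomial f \<Longrightarrow> line_polynomial (\<lambda>w. f w ^ k)"
  by (induction k) (auto intro!: line_polynomial_mult)

lemma line_polynomial_prod: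
  "finite A \<Longrightarrow> (\<And>i. i \<in> A \<Longrightarrow> line_polynomial (f i)) \<Longrightarrow> line_polynomial (\<lambda>w. \<Prod>i\<in>A. f i w)"
  by (induction A rule: finite_induct) auto

text \<open>Two points with nonzero value are joined inside the complex line through them: its part
  in \<open>S\<close> is an open convex subset of the plane, which stays connected when finitely
  many roots are removed.\<close>

lemma line_polynomial_connected:
  assumes f: "line_polynomial f" and S: "open S" "convex S"
  shows "connected (S \<inter> {w. f w \<noteq> 0})"
  unfolding connected_iff_connected_component
proof (intro ballI)
  fix u v assume u: "u \<in> S \<inter> {w. f w \<noteq> 0}" and v: "v \<in> S \<inter> {w. f w \<noteq> 0}"
  define \<gamma> where "\<gamma> t = (fst u + t * (fst v - fst u), snd u + t * (snd v - snd u))" for t :: complex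
  have cont: "continuous_on A \<gamma>" for A
    unfolding \<gamma>_def by (intro continuous_intros)
  obtain P where P: "\<And>t. poly P t = f (\<gamma> t)"
    using f unfolding line_polynomial_def \<gamma>_def by blast
  have \<gamma>01: "\<gamma> 0 = u" "\<gamma> 1 = v" by (simp_all add: \<gamma>_def)
  then have "P \<noteq> 0" using P[of 0] u by auto
  then have fin: "finite {t. poly P t = 0}" by (rule poly_roots_finite)
  define L where "L = \<gamma> -` S"
  have "open L" unfolding L_def using open_vimage[OF S(1) cont] by simp
  moreover have "convex L"
  proof (rule convexI)
    fix s t and a b :: real assume *: "s \<in> L" "t \<in> L" "0 \<le> a" "0 \<le> b" "a + b = 1"
    have one: "complex_of_real a + complex_of_real b = 1" using *(5) by (metis of_real_1 of_real_add)
    have "x + (a *\<^sub>R s + b *\<^sub>R t) * y = a *\<^sub>R (x + s * y) + b *\<^sub>R (x + t * y)" for x y :: complex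
    proof -
      have "x + (a *\<^sub>R s + b *\<^sub>R t) * y = (complex_of_real a + complex_of_real b) * x + (a *\<^sub>R s + b *\<^sub>R t) * y"
        by (simp add: one)
      also have "\<dots> = a *\<^sub>R (x + s * y) + b *\<^sub>R (x + t * y)"
        by (simp add: scaleR_conv_of_real algebra_simps)
      finally show ?thesis .
    qed
    then have "\<gamma> (a *\<^sub>R s + b *\<^sub>R t) = a *\<^sub>R \<gamma> s + b *\<^sub>R \<gamma> t" by (simp add: \<gamma>_def)
    then show "a *\<^sub>R s + b *\<^sub>R t \<in> L"
      using * convexD[OF S(2), of "\<gamma> s" "\<gamma> t" a b] by (simp add: L_def)
  qed
  ultimately have "connected (L - {t. poly P t = 0})"
    by (intro connected_open_diff_countable convex_connected countable_finite fin) auto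
  then have "connected (\<gamma> ` (L - {t. poly P t = 0}))"
    by (intro connected_continuous_image cont)
  moreover have "\<gamma> ` (L - {t. poly P t = 0}) \<subseteq> S \<inter> {w. f w \<noteq> 0}" by (auto simp: L_def P)
  moreover have "0 \<in> L - {t. poly P t = 0}" "1 \<in> L - {t. poly P t = 0}"
    using u v by (auto simp: L_def P \<gamma>01)
  then have "u \<in> \<gamma> ` (L - {t. poly P t = 0})" "v \<in> \<gamma> ` (L - {t. poly P t = 0})"
    using \<gamma>01 by (metis imageI)+
  ultimately show "connected_component (S \<inter> {w. f w \<noteq> 0}) u v"
    unfolding connected_component_def by blast
qed

text \<open>On the complex line from \<open>u\<close> to \<open>v\<close> there are finitely many
  roots, but infinitely many parameters lead into \<open>S\<close>.\<close>

lemma line_polynomial_dense: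
  assumes f: "line_polynomial f" and S: "open S" "u \<in> S" and v: "f v \<noteq> 0"
  shows "\<exists>w\<in>S. f w \<noteq> 0"
proof -
  define \<gamma> where "\<gamma> t = (fst u + t * (fst v - fst u), snd u + t * (snd v - snd u))" for t :: complex
  have cont: "continuous_on A \<gamma>" for A
    unfolding \<gamma>_def by (intro continuous_intros)
  obtain P where P: "\<And>t. poly P t = f (\<gamma> t)"
    using f unfolding line_polynomial_def \<gamma>_def by blast
  have \<gamma>01: "\<gamma> 0 = u" "\<gamma> 1 = v" by (simp_all add: \<gamma>_def)
  then have "P \<noteq> 0" using P[of 1] v by auto
  then have fin: "finite {t. poly P t = 0}" by (rule poly_roots_finite)
  have "open (\<gamma> -` S)" using open_vimage[OF S(1) cont] by simp
  moreover have "0 \<in> \<gamma> -` S" using S \<gamma>01 by simp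
  ultimately have "infinite (\<gamma> -` S)" using finite_imp_not_open by blast
  then have "\<not> \<gamma> -` S \<subseteq> {t. poly P t = 0}" using fin finite_subset by blast
  then show ?thesis using P by auto
qed

text \<open>Each sheet \<open>F i = 0\<close> is a copy of \<open>C^2\<close>, parametrised by
  \<open>e i\<close>, with inverse coordinates \<open>r i\<close> defined on the whole space. By the
  last two assumptions, the points of a sheet that lie on no other sheet are dense in it and form a
  connected set over every convex open set of parameters.\<close>

locale arrangement =
  fixes n :: nat and F :: "nat \<Rightarrow> 'a::euclidean_space \<Rightarrow> complex"
    and e :: "nat \<Rightarrow> complex \<times> complex \<Rightarrow> 'a" and r :: "nat \<Rightarrow> 'a \<Rightarrow> complex \<times> complex"
  assumes continuous_F: "i < n \<Longrightarrow> continuous_on A (F i)"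
    and continuous_e: "i < n \<Longrightarrow> continuous_on B (e i)"
    and continuous_r: "i < n \<Longrightarrow> continuous_on A (r i)"
    and r_e: "i < n \<Longrightarrow> r i (e i w) = w"
    and F_e: "i < n \<Longrightarrow> F i (e i w) = 0"
    and e_r: "i < n \<Longrightarrow> F i x = 0 \<Longrightarrow> e i (r i x) = x"
    and e_0: "i < n \<Longrightarrow> e i 0 = 0"
    and line_polynomial_F_e: "i < n \<Longrightarrow> j < n \<Longrightarrow> line_polynomial (\<lambda>w. F j (e i w))"
    and generic_point: "i < n \<Longrightarrow> \<exists>w. \<forall>j<n. j \<noteq> i \<longrightarrow> F j (e i w) \<noteq> 0"
begin

definition support :: "'a set" where
  "support = {x. \<exists>i<n. F i x = 0}"

definition generic :: "nat \<Rightarrow> (complex \<times> complex) set" where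
  "generic i = {w. \<forall>j<n. j \<noteq> i \<longrightarrow> F j (e i w) \<noteq> 0}"

lemma generic_line_polynomial:
  assumes "i < n"
  obtains Q where "line_polynomial Q" "generic i = {w. Q w \<noteq> 0}"
proof
  show "line_polynomial (\<lambda>w. \<Prod>j\<in>{..<n} - {i}. F j (e i w))"
    using assms by (intro line_polynomial_prod line_polynomial_F_e) auto
  show "generic i = {w. (\<Prod>j\<in>{..<n} - {i}. F j (e i w)) \<noteq> 0}"
    by (auto simp: generic_def)
qed

lemma generic_connected: "i < n \<Longrightarrow> open S \<Longrightarrow> convex S \<Longrightarrow> connected (S \<inter> generic i)"
  by (metis generic_line_polynomial line_polynomial_connected)

lemma generic_dense:
  assumes "i < n" "open S" "u \<in> S"
  shows "\<exists>w\<in>S. w \<in> generic i"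
proof -
  obtain Q where Q: "line_polynomial Q" "generic i = {w. Q w \<noteq> 0}"
    using generic_line_polynomial assms(1) by blast
  obtain v where "v \<in> generic i" using generic_point[OF assms(1)] by (auto simp: generic_def)
  then show ?thesis using line_polynomial_dense[OF Q(1) assms(2,3), of v] Q(2) by auto
qed

lemma vimage_open: "open D \<Longrightarrow> i < n \<Longrightarrow> open (e i -` D)"
  using open_vimage[of D "e i"] continuous_e[of i UNIV] by blast

lemma vimage_r_open: "open D \<Longrightarrow> i < n \<Longrightarrow> open (r i -` D)"
  using open_vimage[of D "r i"] continuous_r[of i UNIV] by blast

lemma open_off: "i < n \<Longrightarrow> open {x. F i x \<noteq> 0}"
  using open_vimage[of "- {0}" "F i"] continuous_F[of i UNIV] by (simp add: vimage_def open_Compl)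

lemma eventually_F_eq_imp:
  assumes "i < n" "j < n" "\<forall>\<^sub>F x in nhds 0. F i x = 0 \<longrightarrow> F j x = 0"
  shows "i = j"
proof (rule ccontr)
  assume ij: "i \<noteq> j"
  obtain S where S: "open S" "0 \<in> S" "\<And>x. x \<in> S \<Longrightarrow> F i x = 0 \<Longrightarrow> F j x = 0"
    using assms(3) unfolding eventually_nhds by blast
  have "0 \<in> e i -` S" using S e_0 assms(1) by simp
  then obtain w where "w \<in> e i -` S" "w \<in> generic i"
    using generic_dense[OF assms(1) vimage_open[OF S(1) assms(1)]] by blast
  then show False using S(3)[of "e i w"] F_e assms(1,2) ij by (auto simp: generic_def)
qed

end

text \<open>Invariance of domain: two distinct sheets through \<open>h x\<close> would both have image an open
  neighbourhood of \<open>x\<close> in the sheet of \<open>x\<close>, hence coincide near \<open>h x\<close>.\<close>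

lemma homeomorphism_simple_point:
  assumes A: "arrangement n F e r" and B: "arrangement n F' e' r'"
    and hom: "homeomorphism U V h g" and U: "open U" and V: "open V"
    and hX: "h ` (arrangement.support n F \<inter> U) = arrangement.support n F' \<inter> V"
    and x: "x \<in> U" "i < n" "F i x = 0" "\<And>l. l < n \<Longrightarrow> l \<noteq> i \<Longrightarrow> F l x \<noteq> 0"
    and jk: "j < n" "k < n" "j \<noteq> k" "F' j (h x) = 0"
  shows "F' k (h x) \<noteq> 0"
proof
  interpret A: arrangement n F e r by (rule A)
  interpret B: arrangement n F' e' r' by (rule B)
  assume k0: "F' k (h x) = 0"
  have hg: "\<And>x. x \<in> U \<Longrightarrow> g (h x) = x" "\<And>y. y \<in> V \<Longrightarrow> h (g y) = y" "\<And>x. x \<in> U \<Longrightarrow> h x \<in> V"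
    "\<And>y. y \<in> V \<Longrightarrow> g y \<in> U"
    using hom by (auto simp: homeomorphism_def)
  have cg: "continuous_on V g" using hom by (simp add: homeomorphism_def)
  \<comment> \<open>A neighbourhood of \<open>x\<close> that meets no sheet except sheet
    \<open>i\<close>.\<close>
  define O' where "O' = U \<inter> (\<Inter>l\<in>{..<n} - {i}. {x. F l x \<noteq> 0})"
  have "open O'" unfolding O'_def using U A.open_off by (intro open_Int open_INT) auto
  have "x \<in> O'" using x by (auto simp: O'_def)
  define W where "W = V \<inter> g -` O'"
  have "open W" unfolding W_def using cg V \<open>open O'\<close> by (rule continuous_open_preimage)
  define D where "D m = e' m -` W" for m
  have oD: "open (D m)" if "m < n" for m unfolding D_def using that \<open>open W\<close> by (rule B.vimage_open[rotated])
  \<comment> \<open>Sheet \<open>m\<close> of the target, pulled back by \<open>g\<close> and read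
    in the coordinates of sheet \<open>i\<close>: a continuous injection between subsets of
    \<open>C^2\<close>, so its image is open.\<close>
  define \<psi> where "\<psi> m w = r i (g (e' m w))" for m w
  have sheet: "F i (g (e' m w)) = 0" "g (e' m w) \<in> U" "e' m w \<in> V" if "m < n" "w \<in> D m" for m w
  proof -
    have y: "e' m w \<in> V" "g (e' m w) \<in> O'" using that(2) by (auto simp: D_def W_def)
    then show "g (e' m w) \<in> U" "e' m w \<in> V" by (auto simp: O'_def)
    have "e' m w \<in> B.support" using B.F_e[OF that(1), of w] that(1) by (auto simp: B.support_def)
    then have "e' m w \<in> h ` (A.support \<inter> U)" using y hX by blast
    then have "g (e' m w) \<in> A.support" using hg(1) by auto
    then show "F i (g (e' m w)) = 0" using y(2) by (auto simp: A.support_def O'_def)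
  qed
  have cont: "continuous_on (D m) (\<psi> m)" if m: "m < n" for m
  proof -
    have "continuous_on (D m) (\<lambda>w. g (e' m w))"
      by (rule continuous_on_compose2[OF cg B.continuous_e[OF m]]) (use sheet[OF m] in auto)
    then show ?thesis unfolding \<psi>_def
      by (rule continuous_on_compose2[OF A.continuous_r[OF x(2), of UNIV]]) auto
  qed
  have eq: "e' m w = e' m' w'" if "m < n" "m' < n" "w \<in> D m" "w' \<in> D m'" "\<psi> m w = \<psi> m' w'" for m m' w w'
  proof -
    have "g (e' m w) = g (e' m' w')"
      using that(5) A.e_r[OF x(2) sheet(1)[OF that(1,3)]] A.e_r[OF x(2) sheet(1)[OF that(2,4)]]
      unfolding \<psi>_def by metis
    then show ?thesis using hg(2) sheet(3) that by metis
  qed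
  have inj: "inj_on (\<psi> m) (D m)" if m: "m < n" for m
    by (rule inj_onI) (metis eq B.r_e m)
  have opn: "open (\<psi> m ` D m)" if m: "m < n" for m
    by (rule invariance_of_domain[OF cont[OF m] oD[OF m] inj[OF m]])
  define p where "p = r' j (h x)"
  have ej: "e' j p = h x" "e' k (r' k (h x)) = h x"
    using B.e_r jk k0 unfolding p_def by auto
  have hW: "h x \<in> W" using x hg \<open>x \<in> O'\<close> by (simp add: W_def)
  have pD: "p \<in> D j" "r' k (h x) \<in> D k" using ej hW by (auto simp: D_def)
  have "\<psi> j p \<in> \<psi> k ` D k" using pD(2) ej by (metis \<psi>_def image_eqI)
  moreover have "open (D j \<inter> \<psi> j -` (\<psi> k ` D k))"
    using cont[OF jk(1)] oD[OF jk(1)] opn[OF jk(2)] by (rule continuous_open_preimage)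
  ultimately obtain w where w: "w \<in> D j \<inter> \<psi> j -` (\<psi> k ` D k)" "w \<in> B.generic j"
    using B.generic_dense[OF jk(1)] pD(1) by (metis IntI vimageI)
  then obtain w' where "w' \<in> D k" "\<psi> j w = \<psi> k w'" by blast
  then have "e' j w = e' k w'" using eq jk w(1) by blast
  then have "F' k (e' j w) = 0" using B.F_e jk by simp
  then show False using w(2) jk by (auto simp: B.generic_def)
qed

text \<open>The generic part of sheet \<open>i\<close> near 0 is connected, and each of its points
  has an image on exactly one sheet. The number of that sheet is therefore constant there, and
  density extends this to the whole sheet near 0.\<close>

lemma homeomorphism_sheet_into_sheet:
  assumes A: "arrangement n F e r" and B: "arrangement n F' e' r'"
    and hom: "homeomorphism U V h g" and U: "open U" "0 \<in> U" and V: "open V"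
    and hX: "h ` (arrangement.support n F \<inter> U) = arrangement.support n F' \<inter> V"
    and i: "i < n"
  shows "\<exists>j<n. \<forall>\<^sub>F x in nhds 0. F i x = 0 \<longrightarrow> F' j (h x) = 0"
proof -
  interpret A: arrangement n F e r by (rule A)
  interpret B: arrangement n F' e' r' by (rule B)
  have ch: "continuous_on U h" using hom by (simp add: homeomorphism_def)
  have "0 \<in> e i -` U" using U A.e_0[OF i] by simp
  then obtain \<delta> where \<delta>: "\<delta> > 0" "ball 0 \<delta> \<subseteq> e i -` U"
    using A.vimage_open[OF U(1) i] open_contains_ball by blast
  define G where "G = ball 0 \<delta> \<inter> A.generic i"
  have conG: "connected G" unfolding G_def by (rule A.generic_connected[OF i]) auto
  have cont: "continuous_on (ball 0 \<delta>) (\<lambda>w. h (e i w))"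
    by (rule continuous_on_compose2[OF ch A.continuous_e[OF i]]) (use \<delta> in auto)
  have sup: "\<exists>j<n. F' j (h (e i w)) = 0" if "w \<in> ball 0 \<delta>" for w
  proof -
    have "e i w \<in> A.support \<inter> U" using that \<delta> A.F_e[OF i, of w] i by (auto simp: A.support_def)
    then show ?thesis using hX by (auto simp: B.support_def)
  qed
  have simple: "F' k (h (e i w)) \<noteq> 0" if "w \<in> G" "j < n" "k < n" "j \<noteq> k" "F' j (h (e i w)) = 0" for w j k
    by (rule homeomorphism_simple_point[OF A B hom U(1) V hX, of "e i w" i j k])
      (use that \<delta> i A.F_e in \<open>auto simp: G_def A.generic_def\<close>)
  obtain w0 where w0: "w0 \<in> G"
    using A.generic_dense[OF i, of "ball 0 \<delta>" 0] \<delta>(1) by (auto simp: G_def)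
  then obtain j where j: "j < n" "F' j (h (e i w0)) = 0" using sup[of w0] unfolding G_def by blast
  have opF: "open (ball 0 \<delta> \<inter> (\<lambda>w. h (e i w)) -` {y. F' k y \<noteq> 0})" if "k < n" for k
    by (rule continuous_open_preimage[OF cont open_ball B.open_off[OF that]])
  \<comment> \<open>\<open>P\<close> collects the parameters whose image is off sheet
    \<open>j\<close>, \<open>Q\<close> those whose image is off all other sheets. Both are open,
    they are disjoint because every image lies on some sheet, and they cover the generic part. The
    extra ball in \<open>Q\<close> matters when there is no other sheet.\<close>
  define P where "P = ball 0 \<delta> \<inter> (\<lambda>w. h (e i w)) -` {y. F' j y \<noteq> 0}"
  define Q where "Q = (\<Inter>k\<in>{..<n} - {j}. ball 0 \<delta> \<inter> (\<lambda>w. h (e i w)) -` {y. F' k y \<noteq> 0}) \<inter> ball 0 \<delta>"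
  have "open P" unfolding P_def by (rule opF[OF j(1)])
  moreover have "open Q" unfolding Q_def
    by (intro open_Int open_INT open_ball ballI opF) auto
  moreover have "G \<subseteq> P \<union> Q"
  proof
    fix w assume w: "w \<in> G"
    show "w \<in> P \<union> Q"
    proof (cases "F' j (h (e i w)) = 0")
      case True
      then show ?thesis using simple[OF w j(1)] w by (auto simp: Q_def G_def)
    next
      case False
      then show ?thesis using w by (auto simp: P_def G_def)
    qed
  qed
  moreover have "P \<inter> Q \<inter> G = {}"
  proof -
    have False if w: "w \<in> P" "w \<in> Q" for w
    proof -
      obtain m where "m < n" "F' m (h (e i w)) = 0" using sup[of w] w by (auto simp: P_def)
      then show False using w unfolding P_def Q_def by (cases "m = j") blast+
    qed
    then show ?thesis by blast
  qed
  moreover have "Q \<inter> G \<noteq> {}"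
    using w0 simple[OF w0 j(1)] j(2) by (auto simp: Q_def G_def)
  ultimately have "P \<inter> G = {}" using connectedD[OF conG, of P Q] by blast
  then have G0: "F' j (h (e i w)) = 0" if "w \<in> G" for w using that by (auto simp: P_def G_def)
  have "P = {}"
  proof (rule ccontr)
    assume "P \<noteq> {}"
    then obtain w where "w \<in> P" "w \<in> A.generic i" using A.generic_dense[OF i, of P] opF[OF j(1)] P_def by blast
    then show False using G0[of w] by (auto simp: P_def G_def)
  qed
  then have all: "F' j (h (e i w)) = 0" if "w \<in> ball 0 \<delta>" for w using that by (auto simp: P_def)
  have "r i 0 = 0" using A.r_e[OF i, of 0] A.e_0[OF i] by simp
  then have "0 \<in> r i -` ball 0 \<delta>" using \<delta>(1) by simp
  moreover have "open (r i -` ball 0 \<delta>)" by (rule A.vimage_r_open[OF open_ball i])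
  moreover have "F' j (h x) = 0" if "x \<in> r i -` ball 0 \<delta>" "F i x = 0" for x
    using all[of "r i x"] A.e_r[OF i that(2)] that(1) by simp
  ultimately show ?thesis using j(1) unfolding eventually_nhds by blast
qed

text \<open>Applied to \<open>h\<close> and to its inverse, the previous lemma gives maps \<sigma>
  and \<tau> of indices. Sheet \<open>i\<close> is then contained near 0 in sheet
  \<open>\<tau> (\<sigma> i)\<close>, which forces equality of the indices.\<close>

lemma homeomorphism_permutes_sheets:
  assumes A: "arrangement n F e r" and B: "arrangement n F' e' r'"
    and hom: "homeomorphism U V h g" and U: "open U" "0 \<in> U" and V: "open V" and h0: "h 0 = 0"
    and hX: "h ` (arrangement.support n F \<inter> U) = arrangement.support n F' \<inter> V"
  shows "\<exists>\<sigma>. bij_betw \<sigma> {..<n} {..<n} \<and>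
    (\<forall>i<n. \<forall>\<^sub>F x in nhds 0. F i x = 0 \<longleftrightarrow> F' (\<sigma> i) (h x) = 0)"
proof -
  interpret A: arrangement n F e r by (rule A)
  interpret B: arrangement n F' e' r' by (rule B)
  have hg: "\<And>x. x \<in> U \<Longrightarrow> g (h x) = x" "\<And>y. y \<in> V \<Longrightarrow> h (g y) = y" "\<And>x. x \<in> U \<Longrightarrow> h x \<in> V"
    using hom by (auto simp: homeomorphism_def)
  have V0: "0 \<in> V" "g 0 = 0" using hg(3)[OF U(2)] hg(1)[OF U(2)] h0 by auto
  have hom': "homeomorphism V U g h" using hom by (simp add: homeomorphism_symD)
  have hX': "g ` (B.support \<inter> V) = A.support \<inter> U"
    unfolding hX[symmetric] image_image using hg(1) by force
  obtain \<sigma> where \<sigma>: "\<And>i. i < n \<Longrightarrow> \<sigma> i < n"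
      "\<And>i. i < n \<Longrightarrow> \<forall>\<^sub>F x in nhds 0. F i x = 0 \<longrightarrow> F' (\<sigma> i) (h x) = 0"
    using homeomorphism_sheet_into_sheet[OF A B hom U V hX] by metis
  obtain \<tau> where \<tau>: "\<And>i. i < n \<Longrightarrow> \<tau> i < n"
      "\<And>i. i < n \<Longrightarrow> \<forall>\<^sub>F y in nhds 0. F' i y = 0 \<longrightarrow> F (\<tau> i) (g y) = 0"
    using homeomorphism_sheet_into_sheet[OF B A hom' V V0(1) U(1) hX'] by metis
  have evU: "\<forall>\<^sub>F x in nhds 0. x \<in> U" "\<forall>\<^sub>F y in nhds 0. y \<in> V"
    using U V V0 by (auto intro: eventually_nhds_in_open)
  have "isCont h 0" "isCont g 0"
    using hom U V V0 by (simp_all add: homeomorphism_def continuous_on_eq_continuous_at)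
  then have lim: "filterlim h (nhds 0) (nhds 0)" "filterlim g (nhds 0) (nhds 0)"
    using h0 V0 by (simp_all add: isCont_def tendsto_nhds_iff)
  have \<tau>\<sigma>: "\<tau> (\<sigma> i) = i" if i: "i < n" for i
  proof -
    have "\<forall>\<^sub>F x in nhds 0. F' (\<sigma> i) (h x) = 0 \<longrightarrow> F (\<tau> (\<sigma> i)) (g (h x)) = 0"
      by (rule eventually_compose_filterlim[OF \<tau>(2)[OF \<sigma>(1)[OF i]] lim(1)])
    then have "\<forall>\<^sub>F x in nhds 0. F i x = 0 \<longrightarrow> F (\<tau> (\<sigma> i)) x = 0"
      using \<sigma>(2)[OF i] evU(1) by eventually_elim (use hg in auto)
    then show ?thesis using A.eventually_F_eq_imp i \<sigma>(1) \<tau>(1) by metis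
  qed
  have "inj_on \<sigma> {..<n}" by (rule inj_on_inverseI[of _ \<tau>]) (simp add: \<tau>\<sigma>)
  then have "bij_betw \<sigma> {..<n} {..<n}"
    using \<sigma>(1) endo_inj_surj[of "{..<n}" \<sigma>] by (auto simp: bij_betw_def)
  moreover have "\<forall>\<^sub>F x in nhds 0. F i x = 0 \<longleftrightarrow> F' (\<sigma> i) (h x) = 0" if i: "i < n" for i
  proof -
    have "\<forall>\<^sub>F x in nhds 0. F' (\<sigma> i) (h x) = 0 \<longrightarrow> F (\<tau> (\<sigma> i)) (g (h x)) = 0"
      by (rule eventually_compose_filterlim[OF \<tau>(2)[OF \<sigma>(1)[OF i]] lim(1)])
    then show ?thesis using \<sigma>(2)[OF i] evU(1) by eventually_elim (use hg \<tau>\<sigma>[OF i] in auto)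
  qed
  ultimately show ?thesis by blast
qed

section \<open>Square roots on a punctured neighbourhood\<close>

lemma exp_eq_1E:
  fixes z :: complex
  assumes "exp z = 1"
  obtains m :: int where "z = of_int (2 * m) * pi * \<i>"
proof -
  obtain m :: int where "Re z = 0" "Im z = of_int (2 * m) * pi" using assms unfolding exp_eq_1 by blast
  then have "z = of_int (2 * m) * pi * \<i>" by (simp add: complex_eq_iff)
  then show ?thesis by (rule that)
qed

text \<open>The domain has the homotopy type of a circle, so only the parity \<open>c\<close> of the
  winding number around \<open>z = 0\<close> obstructs a square root. After pulling back by
  \<open>exp\<close> to a convex set a logarithm exists; half of it, corrected by \<open>c\<close>,
  has an exponential that is periodic and descends.\<close>

lemma square_root_on_punctured_product:
  fixes u :: "'a::real_normed_vector \<times> complex \<Rightarrow> complex"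
  assumes B: "open B" "convex B" and \<delta>: "\<delta> > 0"
    and cont: "continuous_on (B \<times> (ball 0 \<delta> - {0})) u"
    and nz: "\<And>b z. b \<in> B \<Longrightarrow> cmod z < \<delta> \<Longrightarrow> z \<noteq> 0 \<Longrightarrow> u (b, z) \<noteq> 0"
  obtains c :: nat and W where "continuous_on (B \<times> (ball 0 \<delta> - {0})) W"
    "\<And>b z. b \<in> B \<Longrightarrow> cmod z < \<delta> \<Longrightarrow> z \<noteq> 0 \<Longrightarrow> u (b, z) = z ^ c * (W (b, z))\<^sup>2"
proof -
  define K where "K = B \<times> {s. Re s < ln \<delta>}"
  have expK: "exp (Re s) < \<delta>" if "Re s < ln \<delta>" for s
    using that \<delta> by (metis exp_less_cancel_iff exp_ln)
  have "convex K" unfolding K_def by (intro convex_Times B convex_halfspace_Re_lt)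
  have "continuous_on K (\<lambda>x. u (fst x, exp (snd x)))"
    by (rule continuous_on_compose2[OF cont]) (auto intro!: continuous_intros simp: K_def expK)
  then obtain w where w: "continuous_on K w" "\<And>x. x \<in> K \<Longrightarrow> u (fst x, exp (snd x)) = exp (w x)"
    by (rule continuous_logarithm_on_contractible)
      (use convex_imp_contractible[OF \<open>convex K\<close>] nz expK in \<open>auto simp: K_def\<close>)
  \<comment> \<open>The monodromy of the logarithm: continuous with values in the discrete set of
    multiples of \<open>2 * pi * \<i>\<close>, hence constant.\<close>
  define \<Delta> where "\<Delta> x = w (fst x, snd x + 2 * of_real pi * \<i>) - w x" for x
  have exp\<Delta>: "exp (\<Delta> x) = 1" if "x \<in> K" for x
  proof -
    have "(fst x, snd x + 2 * of_real pi * \<i>) \<in> K" using that by (auto simp: K_def)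
    then have "exp (w (fst x, snd x + 2 * of_real pi * \<i>)) = exp (w x)"
      using w(2)[OF that] w(2)[of "(fst x, snd x + 2 * of_real pi * \<i>)"] by (simp add: exp_add)
    then show ?thesis by (simp add: \<Delta>_def exp_diff)
  qed
  have "\<Delta> constant_on K"
  proof (rule continuous_discrete_range_constant)
    show "connected K" by (rule convex_connected[OF \<open>convex K\<close>])
    show "continuous_on K \<Delta>"
      unfolding \<Delta>_def
    proof (intro continuous_on_diff w(1))
      show "continuous_on K (\<lambda>x. w (fst x, snd x + 2 * of_real pi * \<i>))"
        by (rule continuous_on_compose2[OF w(1)]) (auto intro!: continuous_intros simp: K_def)
    qed
    fix x assume x: "x \<in> K"
    show "\<exists>e>0. \<forall>y. y \<in> K \<and> \<Delta> y \<noteq> \<Delta> x \<longrightarrow> e \<le> norm (\<Delta> y - \<Delta> x)"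
    proof (rule exI[of _ "2 * pi"], intro conjI allI impI)
      fix y assume "y \<in> K \<and> \<Delta> y \<noteq> \<Delta> x"
      moreover obtain m where "\<Delta> x = of_int (2 * m) * pi * \<i>"
        using exp\<Delta>[OF x] exp_eq_1E by blast
      moreover obtain l where "\<Delta> y = of_int (2 * l) * pi * \<i>"
        using exp\<Delta>[of y] calculation(1) exp_eq_1E by blast
      ultimately have lm: "l \<noteq> m" and eq: "\<Delta> y - \<Delta> x = of_int (2 * (l - m)) * pi * \<i>"
        by (auto simp: algebra_simps)
      define q where "q = l - m"
      have "norm (\<Delta> y - \<Delta> x) = 2 * pi * \<bar>of_int q\<bar>"
        unfolding eq q_def[symmetric] by (simp add: norm_mult)
      moreover have "1 \<le> \<bar>of_int q :: real\<bar>" using lm unfolding q_def by linarith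
      ultimately show "2 * pi \<le> norm (\<Delta> y - \<Delta> x)" by simp
    qed simp
  qed
  then obtain d where d: "\<And>x. x \<in> K \<Longrightarrow> \<Delta> x = d" by (auto simp: constant_on_def)
  obtain k :: int where k: "\<And>x. x \<in> K \<Longrightarrow> \<Delta> x = of_int (2 * k) * pi * \<i>"
  proof (cases "K = {}")
    case True then show ?thesis using that by blast
  next
    case False
    then obtain x where "x \<in> K" by blast
    then have "exp d = 1" using exp\<Delta> d by metis
    then obtain k :: int where "d = of_int (2 * k) * pi * \<i>" by (rule exp_eq_1E)
    then show ?thesis using that d by metis
  qed
  define c :: nat where "c = (if even k then 0 else 1)"
  have "even (k - int c)" by (auto simp: c_def)
  then obtain m where m: "k - int c = 2 * m" by blast
  define W' where "W' x = exp ((w x - of_nat c * snd x) / 2)" for x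
  have per: "W' (b, s + 2 * of_real pi * \<i>) = W' (b, s)" if "(b, s) \<in> K" for b s
  proof -
    have kc: "(of_int k :: complex) = 2 * of_int m + of_nat c"
      using arg_cong[OF m, of "of_int :: int \<Rightarrow> complex"] by (simp add: diff_eq_eq)
    have "w (b, s + 2 * of_real pi * \<i>) = w (b, s) + of_int (2 * k) * pi * \<i>"
      using k[OF that] by (simp add: \<Delta>_def diff_eq_eq)
    then have shift: "(w (b, s + 2 * of_real pi * \<i>) - of_nat c * (s + 2 * of_real pi * \<i>)) / 2
        = (w (b, s) - of_nat c * s) / 2 + (2 * of_int m * pi) * \<i>"
      by (simp add: kc field_simps)
    have one: "exp ((2 * of_int m * pi) * \<i>) = (1 :: complex)"
      unfolding exp_eq_1 by (auto intro: exI[of _ m])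
    show ?thesis unfolding W'_def fst_conv snd_conv shift exp_add one by simp
  qed
  have cW': "continuous_on K W'"
    unfolding W'_def by (intro continuous_intros w(1)) auto
  \<comment> \<open>The jump of \<open>Ln\<close> is harmless because \<open>W'\<close> is periodic.
    Near the negative axis continuity is read off from the branch
    \<open>Ln (- z) + pi * \<i>\<close> instead.\<close>
  define W where "W x = W' (fst x, Ln (snd x))" for x
  have LnK: "(b, Ln z) \<in> K" if "b \<in> B" "cmod z < \<delta>" "z \<noteq> 0" for b z
    using that \<delta> by (simp add: K_def)
  define S where "S = B \<times> (ball 0 \<delta> - {0 :: complex})"
  have branch: "W x = W' (fst x, Ln (- snd x) + of_real pi * \<i>)" if "x \<in> S" for x
  proof -
    have x: "fst x \<in> B" "cmod (snd x) < \<delta>" "snd x \<noteq> 0" using that by (auto simp: S_def)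
    have "Ln (- snd x) + of_real pi * \<i> = Ln (snd x)
      \<or> Ln (- snd x) + of_real pi * \<i> = Ln (snd x) + 2 * of_real pi * \<i>"
      using Ln_minus[OF x(3)] by (auto simp: algebra_simps)
    then show ?thesis using per[OF LnK[OF x]] by (elim disjE) (simp_all only: W_def)
  qed
  have oS: "open S" unfolding S_def by (intro open_Times B open_Diff open_ball) auto
  define S1 S2 where "S1 = S \<inter> {x. snd x \<notin> \<real>\<^sub>\<le>\<^sub>0}" and "S2 = S \<inter> {x. - snd x \<notin> \<real>\<^sub>\<le>\<^sub>0}"
  have "open (- (\<real>\<^sub>\<le>\<^sub>0 :: complex set))" by (simp add: open_Compl closed_nonpos_Reals_complex)
  then have "open (snd -` (- (\<real>\<^sub>\<le>\<^sub>0 :: complex set)) :: ('a \<times> complex) set)"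
    "open ((\<lambda>x. - snd x) -` (- (\<real>\<^sub>\<le>\<^sub>0 :: complex set)) :: ('a \<times> complex) set)"
    by (auto intro!: open_vimage continuous_intros)
  then have oS12: "open S1" "open S2"
    unfolding S1_def S2_def using oS by (auto simp: vimage_def intro!: open_Int)
  have "continuous_on S1 W" unfolding W_def
    by (rule continuous_on_compose2[OF cW'])
      (auto intro!: continuous_intros LnK simp: S1_def S_def)
  moreover have "continuous_on S2 W"
  proof -
    have "continuous_on S2 (\<lambda>x. W' (fst x, Ln (- snd x) + of_real pi * \<i>))"
      by (rule continuous_on_compose2[OF cW'])
        (auto intro!: continuous_intros simp: S2_def S_def K_def \<delta>)
    then show ?thesis by (rule continuous_on_eq) (simp add: branch S2_def)
  qed
  ultimately have "continuous_on (S1 \<union> S2) W" using oS12 by (intro continuous_on_open_Un)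
  moreover have "S1 \<union> S2 = S"
    by (auto simp: S1_def S2_def S_def complex_nonpos_Reals_iff complex_eq_iff)
  ultimately have "continuous_on (B \<times> (ball 0 \<delta> - {0})) W" by (simp add: S_def)
  moreover have "u (b, z) = z ^ c * (W (b, z))\<^sup>2" if z: "b \<in> B" "cmod z < \<delta>" "z \<noteq> 0" for b z
  proof -
    have "u (b, z) = exp (w (b, Ln z))" using w(2)[OF LnK[OF z]] z by simp
    moreover have "z ^ c = exp (of_nat c * Ln z)" using z(3) by (simp add: exp_of_nat_mult)
    moreover have "(W (b, z))\<^sup>2 = exp (w (b, Ln z) - of_nat c * Ln z)"
      unfolding W_def W'_def by (simp add: power2_eq_square flip: exp_add)
    ultimately show ?thesis by (simp flip: exp_add)
  qed
  ultimately show ?thesis by (rule that)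
qed

section \<open>The embedding of the surfaces\<close>

definition chart :: "complex \<Rightarrow> nat \<Rightarrow> complex \<times> complex \<Rightarrow> complex ^ 3" where
  "chart s i w = (if i < 3 then vector [fst w, snd w, height i (fst w) (snd w)]
     else if i = 3 then vector [fst w, 16 * fst w, snd w] else vector [fst w, s * fst w, snd w])"

definition coords :: "nat \<Rightarrow> complex ^ 3 \<Rightarrow> complex \<times> complex" where
  "coords i v = (if i < 3 then (v $ 1, v $ 2) else (v $ 1, v $ 3))"

lemma vec3_eqI: "a $ 1 = b $ 1 \<Longrightarrow> a $ 2 = b $ 2 \<Longrightarrow> a $ 3 = b $ 3 \<Longrightarrow> a = (b :: 'b ^ 3)"
  by (simp add: vec_eq_iff forall_3)

lemma continuous_on_vector3:
  fixes f g k :: "'a::topological_space \<Rightarrow> complex"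
  assumes "continuous_on S f" "continuous_on S g" "continuous_on S k"
  shows "continuous_on S (\<lambda>x. vector [f x, g x, k x] :: complex ^ 3)"
proof -
  have eq: "(\<lambda>x. vector [f x, g x, k x] :: complex ^ 3) = (\<lambda>x. \<chi> i. if i = 1 then f x else if i = 2 then g x else k x)"
    by (rule ext, rule vec3_eqI) simp_all
  show ?thesis unfolding eq
  proof (rule continuous_on_vec_lambda)
    fix i :: 3
    show "continuous_on S (\<lambda>x. if i = 1 then f x else if i = 2 then g x else k x)"
      using assms by (cases "i = 1"; cases "i = 2") simp_all
  qed
qed

lemma continuous_on_height [continuous_intros]:
  fixes f g :: "'a::topological_space \<Rightarrow> complex"
  assumes "continuous_on S f" "continuous_on S g"
  shows "continuous_on S (\<lambda>x. height k (f x) (g x))"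
  by (cases "(k, 0::complex, 0::complex)" rule: height.cases)
    (auto simp: conic_form_def cross_form_def intro!: continuous_intros assms)

lemma line_polynomial_height:
  assumes "line_polynomial f" "line_polynomial g"
  shows "line_polynomial (\<lambda>w. height k (f w) (g w))"
  using assms by (cases "(k, 0::complex, 0::complex)" rule: height.cases)
    (auto simp: conic_form_def cross_form_def intro!: line_polynomial_const line_polynomial_add line_polynomial_diff
      line_polynomial_mult line_polynomial_power)

lemma height_0_0 [simp]: "height k 0 0 = 0"
  by (cases "(k, 0::complex, 0::complex)" rule: height.cases) (auto simp: conic_form_def cross_form_def)

lemma less_5_cases: "i < 5 \<Longrightarrow> i < 3 \<or> i = 3 \<or> i = (4::nat)"
  by linarith

lemma surface_arrangement:
  assumes s: "s = 1 \<or> s = - 1"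
  shows "arrangement 5 (eqn s) (chart s) coords"
proof
  fix i j :: nat and A and B and w x
  assume i: "i < 5"
  show "continuous_on A (eqn s i)"
    unfolding eqn_def[abs_def] by (cases "i < 3"; cases "i = 3") (auto intro!: continuous_intros)
  show "continuous_on B (chart s i)"
    unfolding chart_def[abs_def]
    by (cases "i < 3"; cases "i = 3") (auto intro!: continuous_on_vector3 continuous_intros)
  show "continuous_on A (coords i)"
    unfolding coords_def[abs_def] by (cases "i < 3") (auto intro!: continuous_intros)
  show "coords i (chart s i w) = w" by (simp add: coords_def chart_def)
  show "eqn s i (chart s i w) = 0" by (simp add: eqn_def chart_def)
  show "chart s i (coords i x) = x" if "eqn s i x = 0"
    using that i by (intro vec3_eqI) (auto simp: chart_def coords_def eqn_def split: if_splits)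
  show "chart s i 0 = 0" by (intro vec3_eqI) (auto simp: chart_def)
  show "line_polynomial (\<lambda>w. eqn s j (chart s i w))" if j: "j < 5"
    using less_5_cases[OF i] less_5_cases[OF j]
    by (elim disjE) (auto simp: eqn_def chart_def intro!: line_polynomial_const line_polynomial_fst
        line_polynomial_snd line_polynomial_diff line_polynomial_mult line_polynomial_height)
  show "\<exists>w. \<forall>j<5. j \<noteq> i \<longrightarrow> eqn s j (chart s i w) \<noteq> 0"
  proof -
    \<comment> \<open>At slope 2 the three heights are distinct and neither plane is met. Over
      slopes 16 and \<open>s\<close>, no graph has height 1, so the parameter \<open>(1, 1)\<close>
      is generic on the planes.\<close>
    have h: "height 0 1 2 = 0" "height 1 1 2 = - 756" "height 2 1 2 = 400"
      "height 0 1 16 = 0" "height 1 1 16 = 0" "height 2 1 16 = 73984"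
      "height 0 1 s = 0" "height 1 1 s = 0" "height 2 1 s = 289"
      using s by (auto simp: height_1 height_2 conic_form_def cross_form_def)
    consider "i < 3" | "i = 3" | "i = 4" using i by linarith
    then show ?thesis
    proof cases
      case 1
      show ?thesis
      proof (rule exI[of _ "(1, 2)"], intro allI impI)
        fix j :: nat assume "j < 5" "j \<noteq> i"
        then show "eqn s j (chart s i (1, 2)) \<noteq> 0"
          using less_5_cases[of j] less_3_cases[of j] less_3_cases[OF 1] h s
          by (auto simp: eqn_def chart_def)
      qed
    next
      case 2
      show ?thesis
      proof (rule exI[of _ "(1, 1)"], intro allI impI)
        fix j :: nat assume "j < 5" "j \<noteq> i"
        then show "eqn s j (chart s i (1, 1)) \<noteq> 0"
          using less_5_cases[of j] less_3_cases[of j] 2 h s by (auto simp: eqn_def chart_def)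
      qed
    next
      case 3
      show ?thesis
      proof (rule exI[of _ "(1, 1)"], intro allI impI)
        fix j :: nat assume "j < 5" "j \<noteq> i"
        then show "eqn s j (chart s i (1, 1)) \<noteq> 0"
          using less_5_cases[of j] less_3_cases[of j] 3 h s by (auto simp: eqn_def chart_def)
      qed
    qed
  qed
qed

lemma support_surface:
  assumes "s = 1 \<or> s = - 1"
  shows "arrangement.support 5 (eqn s) = surface s"
  unfolding arrangement.support_def[OF surface_arrangement[OF assms]] surface_def ..

section \<open>Holomorphy of the defining equations\<close>

definition complex_differentiable :: "(complex ^ 3 \<Rightarrow> complex) \<Rightarrow> bool" where
  "complex_differentiable f \<longleftrightarrow> (\<forall>z. \<exists>D. (f has_derivative D) (at z) \<and> (\<forall>c v. D (c *s v) = c * D v))"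

lemma complex_differentiable_const: "complex_differentiable (\<lambda>z. k)"
  unfolding complex_differentiable_def by (intro allI exI[of _ "\<lambda>_. 0"]) auto

lemma complex_differentiable_nth: "complex_differentiable (\<lambda>z. z $ i)"
  unfolding complex_differentiable_def
  by (intro allI exI[of _ "\<lambda>v. v $ i"]) (auto intro: bounded_linear_imp_has_derivative)

lemma complex_differentiable_add:
  assumes "complex_differentiable f" "complex_differentiable g"
  shows "complex_differentiable (\<lambda>z. f z + g z)"
  unfolding complex_differentiable_def
proof
  fix z
  obtain D E where "(f has_derivative D) (at z)" "\<forall>c v. D (c *s v) = c * D v"
    "(g has_derivative E) (at z)" "\<forall>c v. E (c *s v) = c * E v"
    using assms unfolding complex_differentiable_def by meson
  then show "\<exists>D. ((\<lambda>z. f z + g z) has_derivative D) (at z) \<and> (\<forall>c v. D (c *s v) = c * D v)"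
    by (intro exI[of _ "\<lambda>v. D v + E v"]) (auto intro: has_derivative_add simp: distrib_left)
qed

lemma complex_differentiable_mult:
  assumes "complex_differentiable f" "complex_differentiable g"
  shows "complex_differentiable (\<lambda>z. f z * g z)"
  unfolding complex_differentiable_def
proof
  fix z
  obtain D E where DE: "(f has_derivative D) (at z)" "\<forall>c v. D (c *s v) = c * D v"
    "(g has_derivative E) (at z)" "\<forall>c v. E (c *s v) = c * E v"
    using assms unfolding complex_differentiable_def by meson
  show "\<exists>D. ((\<lambda>z. f z * g z) has_derivative D) (at z) \<and> (\<forall>c v. D (c *s v) = c * D v)"
    using has_derivative_mult[OF DE(1,3)] DE(2,4)
    by (intro exI[of _ "\<lambda>v. f z * E v + D v * g z"]) (simp add: algebra_simps)
qed

lemma complex_differentiable_diff: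
  assumes "complex_differentiable f" "complex_differentiable g"
  shows "complex_differentiable (\<lambda>z. f z - g z)"
  using complex_differentiable_add[OF assms(1) complex_differentiable_mult[OF complex_differentiable_const[of "- 1"] assms(2)]]
  by simp

lemma complex_differentiable_power: "complex_differentiable f \<Longrightarrow> complex_differentiable (\<lambda>z. f z ^ k)"
  by (induction k) (auto intro: complex_differentiable_const complex_differentiable_mult)

lemma complex_differentiable_prod:
  "finite A \<Longrightarrow> (\<And>i. i \<in> A \<Longrightarrow> complex_differentiable (f i)) \<Longrightarrow> complex_differentiable (\<lambda>z. \<Prod>i\<in>A. f i z)"
  by (induction A rule: finite_induct) (auto intro: complex_differentiable_const complex_differentiable_mult)

lemma complex_differentiable_eqn: "complex_differentiable (eqn s i)"
proof -
  note intros = complex_differentiable_const complex_differentiable_nth complex_differentiable_add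
    complex_differentiable_diff complex_differentiable_mult complex_differentiable_power
  have "complex_differentiable (\<lambda>z. height k (z $ 1) (z $ 2))" for k
    by (cases "(k, 0::complex, 0::complex)" rule: height.cases)
      (auto simp: conic_form_def cross_form_def intro!: intros)
  then show ?thesis
    unfolding eqn_def[abs_def] by (cases "i < 3"; cases "i = 3") (auto intro!: intros)
qed

lemma surface_hypersurface_germ:
  assumes s: "s = 1 \<or> s = - 1"
  shows "hypersurface_germ (surface s)"
proof -
  interpret arrangement 5 "eqn s" "chart s" coords by (rule surface_arrangement[OF s])
  define f where "f v = (\<Prod>i<5. eqn s i v)" for v
  have "holomorphic_several_on f UNIV"
    using complex_differentiable_prod[of "{..<5::nat}" "eqn s"] complex_differentiable_eqn
    unfolding holomorphic_several_on_def complex_differentiable_def f_def by auto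
  moreover have "\<not> (\<forall>\<^sub>F z in nhds 0. f z = 0)"
  proof
    assume "\<forall>\<^sub>F z in nhds 0. f z = 0"
    then obtain S where S: "open S" "0 \<in> S" "\<And>z. z \<in> S \<Longrightarrow> f z = 0" unfolding eventually_nhds by blast
    \<comment> \<open>Along this curve the slope 2 avoids both planes, and \<open>z = t\<close>
      dominates the heights, which are of order \<open>t^4\<close>; \<open>t \<le> 1 / 10\<close>
      ensures \<open>400 * t^3 < 1\<close>.\<close>
    define \<gamma> where "\<gamma> t = (vector [of_real t, of_real (2 * t), of_real t] :: complex ^ 3)" for t :: real
    have "continuous_on UNIV \<gamma>"
      unfolding \<gamma>_def by (intro continuous_on_vector3 continuous_intros)
    then have "open (\<gamma> -` S)" using S(1) open_vimage by blast
    moreover have "\<gamma> 0 = 0" by (intro vec3_eqI) (simp_all add: \<gamma>_def)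
    ultimately obtain d where d: "d > 0" "ball 0 d \<subseteq> \<gamma> -` S"
      using S(2) openE[of "\<gamma> -` S" 0] by auto
    define t where "t = min (d / 2) (1 / 10)"
    have t: "0 < t" "t \<le> 1 / 10" "t < d" using d(1) by (auto simp: t_def)
    have "t ^ 3 \<le> (1 / 10) ^ 3" using t by (intro power_mono) auto
    then have t3: "400 * t ^ 3 < 1" by (simp add: power3_eq_cube)
    have "t \<in> ball 0 d" using t by simp
    then have "\<gamma> t \<in> S" using d(2) by blast
    then obtain i where i: "i < 5" "eqn s i (\<gamma> t) = 0" using S(3) by (auto simp: f_def)
    have h: "height 1 (of_real t) (of_real (2 * t)) = of_real (- 756 * t ^ 4)"
      "height 2 (of_real t) (of_real (2 * t)) = of_real (400 * t ^ 4)"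
      by (simp_all add: height_1 height_2 conic_form_def cross_form_def power2_eq_square power4_eq_xxxx algebra_simps)
    consider "i = 0" | "i = 1" | "i = 2" | "i = 3" | "i = 4" using i(1) by linarith
    then show False
    proof cases
      case 1 then show False using i(2) t by (simp add: eqn_def \<gamma>_def)
    next
      case 2
      then have "complex_of_real t = of_real (- 756 * t ^ 4)"
        using i(2) h(1) by (simp add: eqn_def \<gamma>_def)
      then have "t = - 756 * t ^ 4" by (simp only: of_real_eq_iff)
      moreover have "t ^ 4 > 0" using t by simp
      ultimately show False using t by linarith
    next
      case 3
      then have "complex_of_real t = of_real (400 * t ^ 4)"
        using i(2) h(2) by (simp add: eqn_def \<gamma>_def)
      then have "t = (400 * t ^ 3) * t" by (simp only: of_real_eq_iff) (simp add: power4_eq_xxxx power3_eq_cube mult.assoc)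
      then show False using t t3 by simp
    next
      case 4 then show False using i(2) t by (simp add: eqn_def \<gamma>_def)
    next
      case 5 then show False using i(2) t s by (auto simp: eqn_def \<gamma>_def)
    qed
  qed
  moreover have "f 0 = 0"
  proof -
    have "eqn s 3 0 = 0" by (simp add: eqn_def)
    then show ?thesis unfolding f_def by (intro prod_zero bexI[of _ 3]) auto
  qed
  moreover have "surface s \<inter> UNIV = {z \<in> UNIV. f z = 0}" by (auto simp: surface_def f_def)
  ultimately show ?thesis unfolding hypersurface_germ_def by blast
qed

section \<open>Lines along which three sheets meet\<close>

lemma cross_form_eq_0: "cross_form x y = 0 \<longleftrightarrow> x = 0 \<or> y = 0"
  by (simp add: cross_form_def)

text \<open>All three graphs meet only where \<open>p = q = 0\<close>, that is at the origin. Over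
  the lines \<open>y = 16 x\<close> and \<open>y = s x\<close> the forms \<open>p\<close> and
  \<open>q\<close> vanish only at 0, which keeps the third graph away from the other two. The two
  planes meet in the \<open>z\<close>-axis, which meets each graph only at the origin.\<close>

lemma triple_point:
  assumes s: "s = 1 \<or> s = - 1" and lt: "i < j" "j < k" "k < 5"
    and v: "eqn s i v = 0" "eqn s j v = 0" "eqn s k v = 0" "v \<noteq> 0"
  shows "i = 0 \<and> j = 1 \<and> (k = 3 \<or> k = 4)"
proof (rule ccontr)
  assume neg: "\<not> ?thesis"
  define x y z where "x = v $ 1" "y = v $ 2" "z = v $ 3"
  have xyz: "x \<noteq> 0 \<or> y \<noteq> 0 \<or> z \<noteq> 0"
    using v(4) vec3_eqI[of v 0] by (auto simp: x_y_z_def)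
  have E: "eqn s 0 v = z" "eqn s 1 v = z - ((conic_form x y)\<^sup>2 - (cross_form x y)\<^sup>2)" "eqn s 2 v = z - (conic_form x y)\<^sup>2"
    "eqn s 3 v = y - 16 * x" "eqn s 4 v = y - s * x"
    by (simp_all add: eqn_def height_1 height_2 x_y_z_def)
  have line3: "conic_form x y = 272 * x\<^sup>2 \<and> cross_form x y = 272 * x\<^sup>2" if "y = 16 * x"
    by (simp add: that conic_form_def cross_form_def power2_eq_square)
  have line4: "conic_form x y = 17 * x\<^sup>2" if "y = s * x"
    using s by (auto simp: that conic_form_def cross_form_def power2_eq_square)
  have s16: "s \<noteq> 16" using s by auto
  have axes: "x = 0 \<and> y = 0" if "conic_form x y = 0" "cross_form x y = 0"
    using that by (auto simp: conic_form_def cross_form_def)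
  have k: "k = 2 \<or> k = 3 \<or> k = 4" using lt by linarith
  then show False
  proof (elim disjE)
    assume "k = 2"
    moreover then have "i = 0" "j = 1" using lt by auto
    ultimately have "z = 0" "conic_form x y = 0" "cross_form x y = 0" using v E by auto
    then show False using axes xyz by blast
  next
    assume k3: "k = 3"
    then have y: "y = 16 * x" using v E by simp
    have j: "j = 2" using neg k3 lt by auto
    then have "i = 0 \<or> i = 1" using lt by auto
    then show False
      using v E k3 j y line3[OF y] xyz by (auto simp: cross_form_eq_0)
  next
    assume k4: "k = 4"
    then have y: "y = s * x" using v E by simp
    show False
    proof (cases "j = 3")
      case True
      then have "y = 16 * x" using v E by simp
      then have "x = 0" "y = 0" using y s16 by auto
      moreover have "i = 0 \<or> i = 1 \<or> i = 2" using lt True by auto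
      ultimately show False using v E xyz by (auto simp: conic_form_def cross_form_def)
    next
      case False
      then have j: "j = 2" using neg k4 lt by auto
      then have "i = 0 \<or> i = 1" using lt by auto
      then show False
        using v E k4 j y line4[OF y] xyz s by (auto simp: cross_form_eq_0)
    qed
  qed
qed

lemma triple_line:
  assumes "s = 1 \<or> s = - 1" "y = 16 * x \<and> k = 3 \<or> y = s * x \<and> k = 4"
  shows "eqn s 0 (vector [x, y, 0]) = 0" "eqn s 1 (vector [x, y, 0]) = 0" "eqn s k (vector [x, y, 0]) = 0"
  using assms by (auto simp: eqn_def height_1 conic_form_def cross_form_def algebra_simps power2_eq_square)

text \<open>The third graph's equation restricts to minus a square on each of the first two graphs;
  this is the root chosen there, \<open>p\<close> or \<open>q\<close>.\<close>

definition sheet_form :: "nat \<Rightarrow> complex \<times> complex \<Rightarrow> complex" where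
  "sheet_form k w = (if k = 0 then conic_form (fst w) (snd w) else cross_form (fst w) (snd w))"

lemma eqn_2_on_sheet:
  assumes "k < 2" "eqn s k v = 0"
  shows "eqn s 2 v = - (sheet_form k (v $ 1, v $ 2))\<^sup>2"
  using assms by (cases "k = 0") (auto simp: eqn_def height_1 height_2 sheet_form_def less_2_cases_iff)

lemma continuous_sheet_form: "continuous_on A (sheet_form k)"
  unfolding sheet_form_def[abs_def] conic_form_def cross_form_def
  by (cases "k = 0") (auto intro!: continuous_intros)

lemma line_polynomial_sheet_form: "line_polynomial (sheet_form k)"
proof (cases "k = 0")
  case True
  then have eq: "sheet_form k = (\<lambda>w. snd w ^ 2 + 16 * fst w ^ 2)"
    by (auto simp: sheet_form_def conic_form_def)
  show ?thesis unfolding eq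
    by (intro line_polynomial_add line_polynomial_mult line_polynomial_power line_polynomial_const
        line_polynomial_fst line_polynomial_snd)
next
  case False
  then have eq: "sheet_form k = (\<lambda>w. 17 * fst w * snd w)"
    by (auto simp: sheet_form_def cross_form_def)
  show ?thesis unfolding eq
    by (intro line_polynomial_mult line_polynomial_const line_polynomial_fst line_polynomial_snd)
qed

lemma square_1_constant:
  fixes f :: "'a::topological_space \<Rightarrow> complex"
  assumes "connected S" "continuous_on S f" "\<And>x. x \<in> S \<Longrightarrow> (f x)\<^sup>2 = 1"
  shows "\<exists>c. c\<^sup>2 = 1 \<and> (\<forall>x\<in>S. f x = c)"
proof (cases "S = {}")
  case True
  then show ?thesis by (auto intro: exI[of _ 1])
next
  case False
  have "f ` S \<subseteq> {1, - 1}" using assms(3) by (auto simp: power2_eq_1_iff)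
  then have "finite (f ` S)" using finite_subset by blast
  then have "f constant_on S" by (rule continuous_finite_range_constant[OF assms(1,2)])
  then obtain c where c: "\<And>x. x \<in> S \<Longrightarrow> f x = c" unfolding constant_on_def by blast
  obtain x where "x \<in> S" using False by blast
  then have "c\<^sup>2 = 1" using assms(3) c by metis
  then show ?thesis using c by blast
qed

text \<open>As \<open>c\<close> and \<open>d\<close> differ, the two triples are distinct, so their
  common pair is the common pair of \<open>{0, 1, 3}\<close> and \<open>{0, 1, 4}\<close>. It is
  meant for the images of 0, 1, 3, 4, 2 under a permutation of the sheets.\<close>

lemma perm_fixes_triples:
  fixes a b c d m :: nat
  assumes "distinct [a, b, c, d, m]" "{a, b, c, d, m} \<subseteq> {..<5}"
    and 1: "{a, b, c} = {0, 1, 3} \<or> {a, b, c} = {0, 1, 4}"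
    and 2: "{a, b, d} = {0, 1, 3} \<or> {a, b, d} = {0, 1, 4}"
  shows "{a, b} = {0, 1}" "{c, d} = {3, 4}" "m = 2"
proof -
  have cd: "c \<noteq> d" "c \<noteq> a" "c \<noteq> b" "d \<noteq> a" "d \<noteq> b" "a \<noteq> b" using assms(1) by auto
  have S: "0 \<in> S \<and> 1 \<in> S \<and> S \<subseteq> {0, 1, 3, 4}" if "S = {0, 1, 3} \<or> S = {0, 1, 4}" for S :: "nat set"
    using that by auto
  have "0 \<in> {a, b, c}" "1 \<in> {a, b, c}" "0 \<in> {a, b, d}" "1 \<in> {a, b, d}"
    by (rule conjunct1[OF S[OF 1]] conjunct1[OF conjunct2[OF S[OF 1]]]
      conjunct1[OF S[OF 2]] conjunct1[OF conjunct2[OF S[OF 2]]])+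
  then have ab: "a = 0 \<and> b = 1 \<or> a = 1 \<and> b = 0" using cd by auto
  then show "{a, b} = {0, 1}" by auto
  have "c \<in> {0, 1, 3, 4}" "d \<in> {0, 1, 3, 4}"
    using conjunct2[OF conjunct2[OF S[OF 1]]] conjunct2[OF conjunct2[OF S[OF 2]]] by simp_all
  then have "c = 3 \<and> d = 4 \<or> c = 4 \<and> d = 3" using ab cd by auto
  then show "{c, d} = {3, 4}" by auto
  have "m < 5" using assms(2) by auto
  then show "m = 2" using \<open>c = 3 \<and> d = 4 \<or> c = 4 \<and> d = 3\<close> ab assms(1) by auto
qed

text \<open>Stated for germs, so that a homeomorphism defined only near the origin transports
  it.\<close>

definition triple :: "complex \<Rightarrow> nat \<Rightarrow> nat \<Rightarrow> nat \<Rightarrow> bool" where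
  "triple s i j k \<longleftrightarrow> \<not> (\<forall>\<^sub>F x in nhds 0. eqn s i x = 0 \<and> eqn s j x = 0 \<and> eqn s k x = 0 \<longrightarrow> x = 0)"

lemma triple_set:
  assumes s: "s = 1 \<or> s = - 1" and lt: "i < 5" "j < 5" "k < 5" and ne: "i \<noteq> j" "j \<noteq> k" "i \<noteq> k"
    and t: "triple s i j k"
  shows "{i, j, k} = {0, 1, 3} \<or> {i, j, k} = {0, 1, 4}"
proof -
  have "\<not> (\<forall>x. eqn s i x = 0 \<and> eqn s j x = 0 \<and> eqn s k x = 0 \<longrightarrow> x = 0)"
    using t always_eventually unfolding triple_def by blast
  then obtain v where v: "eqn s i v = 0" "eqn s j v = 0" "eqn s k v = 0" "v \<noteq> 0" by blast
  consider "i < j" "j < k" | "i < k" "k < j" | "j < i" "i < k" | "j < k" "k < i" | "k < i" "i < j" | "k < j" "j < i"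
    using ne by linarith
  then show ?thesis
  proof cases
    case 1 show ?thesis using triple_point[OF s 1 lt(3) v(1,2,3,4)] by auto
  next
    case 2 show ?thesis using triple_point[OF s 2 lt(2) v(1,3,2,4)] by auto
  next
    case 3 show ?thesis using triple_point[OF s 3 lt(3) v(2,1,3,4)] by auto
  next
    case 4 show ?thesis using triple_point[OF s 4 lt(1) v(2,3,1,4)] by auto
  next
    case 5 show ?thesis using triple_point[OF s 5 lt(2) v(3,1,2,4)] by auto
  next
    case 6 show ?thesis using triple_point[OF s 6 lt(1) v(3,2,1,4)] by auto
  qed
qed

lemma triple_exists:
  assumes s: "s = 1 \<or> s = - 1" and k: "k = 3 \<or> k = 4"
  shows "triple s 0 1 k"
  unfolding triple_def
proof
  assume "\<forall>\<^sub>F x in nhds 0. eqn s 0 x = 0 \<and> eqn s 1 x = 0 \<and> eqn s k x = 0 \<longrightarrow> x = 0"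
  then obtain S where S: "open S" "0 \<in> S"
    "\<And>x. x \<in> S \<Longrightarrow> eqn s 0 x = 0 \<Longrightarrow> eqn s 1 x = 0 \<Longrightarrow> eqn s k x = 0 \<Longrightarrow> x = 0"
    unfolding eventually_nhds by blast
  define m where "m = (if k = 3 then 16 else s)"
  define \<gamma> where "\<gamma> t = (vector [t, m * t, 0] :: complex ^ 3)" for t
  have "continuous_on UNIV \<gamma>"
    unfolding \<gamma>_def by (intro continuous_on_vector3 continuous_intros)
  then have "open (\<gamma> -` S)" using S(1) open_vimage by blast
  moreover have "\<gamma> 0 = 0" by (intro vec3_eqI) (simp_all add: \<gamma>_def)
  ultimately have "infinite (\<gamma> -` S)"
    using S(2) finite_imp_not_open[of "\<gamma> -` S"] by auto
  then obtain t where t: "t \<in> \<gamma> -` S" "t \<noteq> 0"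
    using finite_subset[of "\<gamma> -` S" "{0}"] by auto
  have "m * t = 16 * t \<and> k = 3 \<or> m * t = s * t \<and> k = 4" using k by (auto simp: m_def)
  from triple_line[OF s this] have "\<gamma> t = 0" using S(3)[of "\<gamma> t"] t(1) by (simp add: \<gamma>_def)
  then have "\<gamma> t $ 1 = 0" by simp
  then show False using t(2) by (simp add: \<gamma>_def)
qed

text \<open>On the sheets \<open>z = 0\<close> and \<open>z = p\<^sup>2 - q\<^sup>2\<close> the equation \<open>z - p\<^sup>2\<close> of the third sheet is \<open>- p\<^sup>2\<close> and
  \<open>- q\<^sup>2\<close>. For \<open>s = 1\<close> the vertical planes lie over lines where \<open>p = q\<close>, so every nonvanishing function
  off the third sheet has square roots on both sheets that agree along the triple lines. For \<open>s = - 1\<close>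
  one of them lies over \<open>p = - q\<close>, and \<open>z - p\<^sup>2\<close> itself has no such pair of square roots.\<close>

lemma surface_not_same_embedded: "\<not> same_embedded_topological_type (surface 1) (surface (- 1))"
proof
  assume "same_embedded_topological_type (surface 1) (surface (- 1))"
  then obtain U V h g where U: "open U" "0 \<in> U" and V: "open V" "0 \<in> V"
    and hom: "homeomorphism U V h g" and h0: "h 0 = 0"
    and hX: "h ` (surface 1 \<inter> U) = surface (- 1) \<inter> V"
    unfolding same_embedded_topological_type_def by blast
  define F where "F = eqn 1"
  define F' where "F' = eqn (- 1)"
  interpret A: arrangement 5 F "chart 1" coords unfolding F_def by (rule surface_arrangement) simp
  interpret B: arrangement 5 F' "chart (- 1)" coords unfolding F'_def by (rule surface_arrangement) simp
  have sup: "A.support = surface 1" "B.support = surface (- 1)"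
    by (simp_all add: F_def F'_def support_surface)
  have hg: "\<And>x. x \<in> U \<Longrightarrow> g (h x) = x" "\<And>y. y \<in> V \<Longrightarrow> h (g y) = y" "\<And>x. x \<in> U \<Longrightarrow> h x \<in> V"
    "\<And>y. y \<in> V \<Longrightarrow> g y \<in> U"
    using hom by (auto simp: homeomorphism_def)
  have ch: "continuous_on U h" and cg: "continuous_on V g" using hom by (auto simp: homeomorphism_def)
  have g0: "g 0 = 0" using hg(1)[OF U(2)] h0 by simp
  have "isCont h 0" "isCont g 0"
    using ch cg U V by (simp_all add: continuous_on_eq_continuous_at)
  then have limh: "filterlim h (nhds 0) (nhds 0)" and limg: "filterlim g (nhds 0) (nhds 0)"
    using h0 g0 by (simp_all add: isCont_def tendsto_nhds_iff)
  obtain \<sigma> where \<sigma>: "bij_betw \<sigma> {..<5} {..<5}"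
    and \<sigma>F: "\<And>i. i < 5 \<Longrightarrow> \<forall>\<^sub>F x in nhds 0. F i x = 0 \<longleftrightarrow> F' (\<sigma> i) (h x) = 0"
    using homeomorphism_permutes_sheets[OF A.arrangement_axioms B.arrangement_axioms hom U V(1) h0] hX
    unfolding sup by blast
  have inj: "\<sigma> i \<noteq> \<sigma> j" if "i < 5" "j < 5" "i \<noteq> j" for i j
    using \<sigma> that by (auto simp: bij_betw_def inj_on_def)
  have \<sigma>5: "\<sigma> i < 5" if "i < 5" for i using bij_betwE[OF \<sigma>] that by auto
  have tr: "triple (- 1) (\<sigma> i) (\<sigma> j) (\<sigma> k)" if "triple 1 i j k" "i < 5" "j < 5" "k < 5" for i j k
    unfolding triple_def
  proof
    assume "\<forall>\<^sub>F y in nhds 0. eqn (- 1) (\<sigma> i) y = 0 \<and> eqn (- 1) (\<sigma> j) y = 0 \<and> eqn (- 1) (\<sigma> k) y = 0 \<longrightarrow> y = 0"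
    then have "\<forall>\<^sub>F x in nhds 0. F' (\<sigma> i) (h x) = 0 \<and> F' (\<sigma> j) (h x) = 0 \<and> F' (\<sigma> k) (h x) = 0 \<longrightarrow> h x = 0"
      unfolding F'_def[symmetric] by (rule eventually_compose_filterlim[OF _ limh])
    moreover have "\<forall>\<^sub>F x in nhds 0. x \<in> U" using U by (rule eventually_nhds_in_open)
    ultimately have "\<forall>\<^sub>F x in nhds 0. F i x = 0 \<and> F j x = 0 \<and> F k x = 0 \<longrightarrow> x = 0"
      using \<sigma>F[OF that(2)] \<sigma>F[OF that(3)] \<sigma>F[OF that(4)]
    proof eventually_elim
      case (elim x)
      then show ?case using hg(1)[OF elim(2)] g0 by auto
    qed
    then show False using that(1) unfolding triple_def F_def by blast
  qed
  have T: "{\<sigma> 0, \<sigma> 1, \<sigma> k} = {0, 1, 3} \<or> {\<sigma> 0, \<sigma> 1, \<sigma> k} = {0, 1, 4}" if k: "k = 3 \<or> k = 4" for k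
  proof (rule triple_set)
    show "triple (- 1) (\<sigma> 0) (\<sigma> 1) (\<sigma> k)"
      using k by (intro tr triple_exists) auto
  qed (use k \<sigma>5 inj in auto)
  \<comment> \<open>The triple lines pin down the permutation as far as required: the third graph is
    fixed, and the first two graphs and the two planes are preserved as pairs.\<close>
  have perm: "{\<sigma> 0, \<sigma> 1} = {0, 1}" "{\<sigma> 3, \<sigma> 4} = {3, 4}" "\<sigma> 2 = 2"
    using perm_fixes_triples[of "\<sigma> 0" "\<sigma> 1" "\<sigma> 3" "\<sigma> 4" "\<sigma> 2"] T inj \<sigma>5 by auto
  have \<sigma>F_all: "\<forall>\<^sub>F x in nhds 0. \<forall>i<5. F i x = 0 \<longleftrightarrow> F' (\<sigma> i) (h x) = 0"
  proof -
    have "\<forall>\<^sub>F x in nhds 0. \<forall>i\<in>{..<5}. F i x = 0 \<longleftrightarrow> F' (\<sigma> i) (h x) = 0"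
      by (rule eventually_ball_finite) (use \<sigma>F in auto)
    then show ?thesis unfolding Ball_def lessThan_iff .
  qed
  then obtain N where N: "open N" "0 \<in> N" "\<And>x i. x \<in> N \<Longrightarrow> i < 5 \<Longrightarrow> F i x = 0 \<longleftrightarrow> F' (\<sigma> i) (h x) = 0"
    unfolding eventually_nhds by blast

  \<comment> \<open>Coordinates that straighten the third graph to \<open>z = 0\<close>, so that its
    complement becomes a ball times a punctured disc.\<close>
  define \<kappa> where "\<kappa> x = (vector [fst (fst x), snd (fst x), snd x + height 2 (fst (fst x)) (snd (fst x))] :: complex ^ 3)"
    for x :: "(complex \<times> complex) \<times> complex"
  have c\<kappa>: "continuous_on S \<kappa>" for S
    unfolding \<kappa>_def by (intro continuous_on_vector3 continuous_intros)
  have "\<kappa> 0 = 0" by (intro vec3_eqI) (simp_all add: \<kappa>_def)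
  moreover have "open (\<kappa> -` (N \<inter> U))" using N(1) U(1) c\<kappa> by (intro open_vimage) auto
  ultimately obtain d where d: "d > 0" "ball 0 d \<subseteq> \<kappa> -` (N \<inter> U)"
    using openE[of "\<kappa> -` (N \<inter> U)" 0] N(2) U(2) by auto
  define \<delta> where "\<delta> = d / 2"
  have \<delta>: "\<delta> > 0" using d by (simp add: \<delta>_def)
  have \<kappa>N: "\<kappa> (b, z) \<in> N" "\<kappa> (b, z) \<in> U" if "b \<in> ball 0 \<delta>" "z \<in> ball 0 \<delta>" for b z
  proof -
    have "norm (b, z) \<le> norm b + norm z" by (rule norm_Pair_le)
    then have "(b, z) \<in> ball 0 d" using that by (simp add: \<delta>_def)
    then show "\<kappa> (b, z) \<in> N" "\<kappa> (b, z) \<in> U" using d(2) by auto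
  qed
  have F2\<kappa>: "F 2 (\<kappa> (b, z)) = z" for b z by (simp add: F_def eqn_def \<kappa>_def)
  have cont: "continuous_on (ball 0 \<delta> \<times> (ball 0 \<delta> - {0})) (\<lambda>x. F' 2 (h (\<kappa> x)))"
  proof (rule continuous_on_compose2[OF B.continuous_F[of 2 UNIV]])
    show "continuous_on (ball 0 \<delta> \<times> (ball 0 \<delta> - {0})) (\<lambda>x. h (\<kappa> x))"
      by (rule continuous_on_compose2[OF ch c\<kappa>]) (use \<kappa>N in auto)
  qed auto
  have nz: "F' 2 (h (\<kappa> (b, z))) \<noteq> 0" if "b \<in> ball 0 \<delta>" "cmod z < \<delta>" "z \<noteq> 0" for b z
    using N(3)[OF \<kappa>N(1)[of b z], of 2] that perm(3) by (simp add: F2\<kappa>)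
  obtain c W where cW: "continuous_on (ball 0 \<delta> \<times> (ball 0 \<delta> - {0})) W"
    and W: "\<And>b z. b \<in> ball 0 \<delta> \<Longrightarrow> cmod z < \<delta> \<Longrightarrow> z \<noteq> 0 \<Longrightarrow> F' 2 (h (\<kappa> (b, z))) = z ^ c * (W (b, z))\<^sup>2"
    by (rule square_root_on_punctured_product[OF open_ball convex_ball \<delta> cont nz]) (assumption | rule that)+

  define N' where "N' = N \<inter> U \<inter> {x. (x $ 1, x $ 2) \<in> ball 0 \<delta> \<and> F 2 x \<in> ball 0 \<delta>}"
  \<comment> \<open>On sheet \<open>k < 2\<close> the third equation is
    \<open>(\<i> * sheet_form k)^2\<close>, so the factor \<open>z ^ c\<close> acquires a root there
    whatever the parity of \<open>c\<close>. \<open>W\<close> is common to both sheets.\<close>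
  define rt where "rt k x = (\<i> * sheet_form k (x $ 1, x $ 2)) ^ c * W ((x $ 1, x $ 2), F 2 x)" for k x
  have cF2: "continuous_on S (F 2)" for S by (rule A.continuous_F) simp
  have "open {x :: complex ^ 3. (x $ 1, x $ 2) \<in> ball 0 \<delta>}"
    using open_vimage[OF open_ball, of "\<lambda>x :: complex ^ 3. (x $ 1, x $ 2)" 0 \<delta>]
    unfolding vimage_def by (simp add: continuous_intros)
  moreover have "open {x. F 2 x \<in> ball 0 \<delta>}"
    using open_vimage[OF open_ball cF2] unfolding vimage_def .
  ultimately have oN': "open N'" unfolding N'_def using N(1) U(1) by (intro open_Int open_Collect_conj)
  have "F 2 0 = 0" using A.F_e[of 2 0] A.e_0[of 2] by simp
  then have N'0: "0 \<in> N'" using N(2) U(2) \<delta> by (simp add: N'_def)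
  have \<kappa>_inv: "\<kappa> ((x $ 1, x $ 2), F 2 x) = x" for x
    by (rule vec3_eqI) (simp_all add: \<kappa>_def F_def eqn_def)
  have rt_sq: "(rt k x)\<^sup>2 = F' 2 (h x)" if "k < 2" "x \<in> N'" "F k x = 0" "F 2 x \<noteq> 0" for k x
  proof -
    have "(rt k x)\<^sup>2 = (- (sheet_form k (x $ 1, x $ 2))\<^sup>2) ^ c * (W ((x $ 1, x $ 2), F 2 x))\<^sup>2"
    proof -
      have "((\<i> * q) ^ c)\<^sup>2 = (- q\<^sup>2) ^ c" for q
        by (subst power_mult[symmetric], subst mult.commute, subst power_mult)
          (simp add: power_mult_distrib)
      then show ?thesis by (simp only: rt_def power_mult_distrib[of "_ ^ c" _ 2])
    qed
    also have "- (sheet_form k (x $ 1, x $ 2))\<^sup>2 = F 2 x"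
      using eqn_2_on_sheet[OF that(1), of 1 x] that(3) by (simp add: F_def)
    also have "F 2 x ^ c * (W ((x $ 1, x $ 2), F 2 x))\<^sup>2 = F' 2 (h x)"
      using W[of "(x $ 1, x $ 2)" "F 2 x"] that(2,4) by (simp add: \<kappa>_inv N'_def)
    finally show ?thesis .
  qed
  have c_rt: "continuous_on (N' \<inter> {x. F 2 x \<noteq> 0}) (rt k)" for k
    unfolding rt_def
  proof (intro continuous_intros)
    show "continuous_on (N' \<inter> {x. F 2 x \<noteq> 0}) (\<lambda>x. sheet_form k (x $ 1, x $ 2))"
      by (rule continuous_on_compose2[OF continuous_sheet_form[of UNIV]]) (auto intro!: continuous_intros)
    show "continuous_on (N' \<inter> {x. F 2 x \<noteq> 0}) (\<lambda>x. W ((x $ 1, x $ 2), F 2 x))"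
      by (rule continuous_on_compose2[OF cW]) (auto intro!: continuous_intros cF2 simp: N'_def)
  qed
  \<comment> \<open>Here \<open>s = 1\<close> enters: \<open>p = q\<close> over both planes of the
    source.\<close>
  have rt_agree: "rt 0 x = rt 1 x" if "F 3 x = 0 \<or> F 4 x = 0" for x
  proof -
    have "sheet_form 0 (x $ 1, x $ 2) = sheet_form 1 (x $ 1, x $ 2)"
      using that by (auto simp: F_def eqn_def sheet_form_def conic_form_def cross_form_def power2_eq_square)
    then show ?thesis by (simp add: rt_def)
  qed

  obtain \<tau> where \<tau>: "\<And>j. j < 2 \<Longrightarrow> \<tau> j < 2 \<and> \<sigma> (\<tau> j) = j"
  proof -
    have "\<exists>k<2. \<sigma> k = j" if "j < 2" for j
    proof -
      have "j \<in> {\<sigma> 0, \<sigma> 1}" unfolding perm(1) using that by auto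
      then consider "\<sigma> 0 = j" | "\<sigma> 1 = j" by blast
      then show ?thesis by cases (auto intro: exI[of _ 0] exI[of _ 1])
    qed
    then show ?thesis using that by metis
  qed
  define M where "M = V \<inter> g -` N'"
  have oM: "open M" unfolding M_def by (rule continuous_open_preimage[OF cg V(1) oN'])
  have M0: "0 \<in> M" using V(2) N'0 g0 by (simp add: M_def)
  have sheetM: "F i (g y) = 0 \<longleftrightarrow> F' (\<sigma> i) y = 0" if "y \<in> M" "i < 5" for y i
    using N(3)[of "g y" i] that hg(2)[of y] by (simp add: M_def N'_def)
  have "\<exists>\<epsilon>>0. \<forall>w\<in>ball 0 \<epsilon>. chart (- 1) j w \<in> M" if "j < 5" for j
  proof -
    have "open (chart (- 1) j -` M)" by (rule B.vimage_open[OF oM that])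
    moreover have "0 \<in> chart (- 1) j -` M" using M0 B.e_0[OF that] by simp
    ultimately show ?thesis by (meson openE subsetD vimageD)
  qed
  from this[of 0] this[of 1] obtain \<epsilon>0 \<epsilon>1 where \<epsilon>01: "\<epsilon>0 > 0" "\<epsilon>1 > 0"
    "\<forall>w\<in>ball 0 \<epsilon>0. chart (- 1) 0 w \<in> M" "\<forall>w\<in>ball 0 \<epsilon>1. chart (- 1) 1 w \<in> M" by auto
  define \<epsilon> where "\<epsilon> = min \<epsilon>0 \<epsilon>1"
  have \<epsilon>: "\<epsilon> > 0" and chM: "\<And>j w. j < 2 \<Longrightarrow> w \<in> ball 0 \<epsilon> \<Longrightarrow> chart (- 1) j w \<in> M"
    using \<epsilon>01 by (auto simp: \<epsilon>_def less_2_cases_iff)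
  \<comment> \<open>The root carried over to sheet \<open>j\<close> of the target. Its square is
    \<open>- (sheet_form j)^2\<close>, so on the connected set where that form is nonzero it equals
    \<open>\<i> * sheet_form j\<close> up to one constant sign.\<close>
  define R where "R j w = rt (\<tau> j) (g (chart (- 1) j w))" for j w
  define G where "G j = ball 0 \<epsilon> \<inter> {w. sheet_form j w \<noteq> 0}" for j
  have F2G: "F' 2 (chart (- 1) j w) = - (sheet_form j w)\<^sup>2" if "j < 2" for j w
  proof -
    have "eqn (- 1) j (chart (- 1) j w) = 0" using B.F_e[of j w] that unfolding F'_def by simp
    moreover have "(chart (- 1) j w $ 1, chart (- 1) j w $ 2) = w" using that by (simp add: chart_def)
    ultimately show ?thesis using eqn_2_on_sheet[OF that] unfolding F'_def by metis
  qed
  have inN: "g (chart (- 1) j w) \<in> N' \<inter> {x. F 2 x \<noteq> 0}" "F (\<tau> j) (g (chart (- 1) j w)) = 0"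
    if "j < 2" "w \<in> G j" for j w
  proof -
    have m: "chart (- 1) j w \<in> M" using chM that by (simp add: G_def)
    then show "g (chart (- 1) j w) \<in> N' \<inter> {x. F 2 x \<noteq> 0}"
      using sheetM[OF m, of 2] perm(3) F2G[OF that(1)] that(2) by (simp add: M_def G_def)
    have "\<tau> j < 5" using \<tau>[OF that(1)] by simp
    then show "F (\<tau> j) (g (chart (- 1) j w)) = 0"
      using sheetM[OF m, of "\<tau> j"] \<tau>[OF that(1)] B.F_e[of j w] that(1) by simp
  qed
  have R_const: "\<exists>c. c\<^sup>2 = 1 \<and> (\<forall>w\<in>G j. R j w / (\<i> * sheet_form j w) = c)" if j: "j < 2" for j
  proof (rule square_1_constant)
    show "connected (G j)" unfolding G_def
      by (rule line_polynomial_connected[OF line_polynomial_sheet_form]) auto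
    have "continuous_on (G j) (R j)" unfolding R_def
    proof (rule continuous_on_compose2[OF c_rt])
      show "continuous_on (G j) (\<lambda>w. g (chart (- 1) j w))"
        by (rule continuous_on_compose2[OF cg B.continuous_e]) (use j chM in \<open>auto simp: G_def M_def\<close>)
    qed (use inN j in auto)
    then show "continuous_on (G j) (\<lambda>w. R j w / (\<i> * sheet_form j w))"
      by (intro continuous_intros continuous_sheet_form) (auto simp: G_def)
    fix w assume w: "w \<in> G j"
    have m: "chart (- 1) j w \<in> V" using chM[OF j] w by (simp add: G_def M_def)
    have "(R j w)\<^sup>2 = - (sheet_form j w)\<^sup>2"
      unfolding R_def using rt_sq[of "\<tau> j" "g (chart (- 1) j w)"] inN[OF j w] \<tau>[OF j]
      by (simp add: hg(2)[OF m] F2G[OF j])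
    then show "(R j w / (\<i> * sheet_form j w))\<^sup>2 = 1"
      using w by (simp add: power_divide power_mult_distrib G_def)
  qed
  from R_const[of 0] R_const[of 1] obtain c0 c1 where c01: "c0\<^sup>2 = 1" "c1\<^sup>2 = 1"
    "\<forall>w\<in>G 0. R 0 w / (\<i> * sheet_form 0 w) = c0" "\<forall>w\<in>G 1. R 1 w / (\<i> * sheet_form 1 w) = c1"
    by auto
  \<comment> \<open>With this size, \<open>(t, 16 * t)\<close> has norm at most
    \<open>17 * \<epsilon> / 20\<close>.\<close>
  define t :: complex where "t = of_real (\<epsilon> / 20)"
  have t: "t \<noteq> 0" "cmod t = \<epsilon> / 20" using \<epsilon> by (auto simp: t_def)
  have agree: "c0 * sheet_form 0 (t, m * t) = c1 * sheet_form 1 (t, m * t)"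
    if m: "m = 16 \<and> k = 3 \<or> m = - 1 \<and> k = 4" for m and k :: nat
  proof -
    define w where "w = (t, m * t)"
    define y where "y = (vector [t, m * t, 0] :: complex ^ 3)"
    have nz: "sheet_form 0 w \<noteq> 0" "sheet_form 1 w \<noteq> 0"
      using m t(1) by (auto simp: w_def sheet_form_def conic_form_def cross_form_def power2_eq_square)
    have "norm w \<le> cmod t + cmod (m * t)" unfolding w_def by (rule norm_Pair_le)
    also have "\<dots> < \<epsilon>" using m t(2) \<epsilon> by (auto simp: norm_mult)
    finally have wb: "w \<in> ball 0 \<epsilon>" by simp
    then have G: "w \<in> G 0" "w \<in> G 1" using nz by (auto simp: G_def)
    have yF: "F' 0 y = 0" "F' 1 y = 0" "F' k y = 0"
      using triple_line[of "- 1" "m * t" t k] m unfolding F'_def y_def by auto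
    have "coords 0 y = w" "coords 1 y = w" by (simp_all add: y_def w_def coords_def)
    then have yc: "chart (- 1) 0 w = y" "chart (- 1) 1 w = y"
      using B.e_r[of 0 y] B.e_r[of 1 y] yF by auto
    then have yM: "y \<in> M" using chM[of 0 w] wb by auto
    \<comment> \<open>It does not matter which source plane corresponds to plane \<open>k\<close>:
      the two roots agree over either.\<close>
    have "k \<in> {\<sigma> 3, \<sigma> 4}" unfolding perm(2) using m by auto
    then have "F 3 (g y) = 0 \<or> F 4 (g y) = 0" using sheetM[OF yM, of 3] sheetM[OF yM, of 4] yF(3) by auto
    then have "rt 0 (g y) = rt 1 (g y)" by (rule rt_agree)
    then have "rt (\<tau> 0) (g y) = rt (\<tau> 1) (g y)"
      using \<tau>[of 0] \<tau>[of 1] by (auto simp: less_2_cases_iff)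
    then have "R 0 w = R 1 w" unfolding R_def yc .
    moreover have "R 0 w = c0 * (\<i> * sheet_form 0 w)" "R 1 w = c1 * (\<i> * sheet_form 1 w)"
      using c01(3,4) G nz by (auto simp: field_simps)
    ultimately show ?thesis by (simp add: w_def)
  qed
  \<comment> \<open>Over \<open>y = 16 x\<close> both forms are \<open>272 * t^2\<close>, so the
    signs agree; over \<open>y = - x\<close> they are \<open>17 * t^2\<close> and
    \<open>- 17 * t^2\<close>, so the signs are opposite.\<close>
  have "c0 = c1" using agree[of 16 3] t(1)
    by (simp add: sheet_form_def conic_form_def cross_form_def power2_eq_square)
  moreover have "(c0 + c1) * (t * t) = 0" using agree[of "- 1" 4]
    by (simp add: sheet_form_def conic_form_def cross_form_def power2_eq_square distrib_right)
  ultimately show False using c01(1) t(1) by simp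
qed

theorem theorem1p1:
  "\<exists>X1 X2 :: (complex ^ 3) set.
     hypersurface_germ X1 \<and> hypersurface_germ X2 \<and>
     same_Lipschitz_outer_geometry X1 X2 \<and>
     \<not> same_embedded_topological_type X1 X2"
  using surface_hypersurface_germ[of 1] surface_hypersurface_germ[of "- 1"]
    surface_same_outer_geometry[of 1] surface_not_same_embedded by auto

end
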